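(* Let $s\in\mathbb{N}$, $k\in\mathbb{Z}$ and $n\in\{0,1,2,\dots\}$. Then $$\tilde e(A_n^* )=1\quad\text{if } k=0\text{ and }n=0,$$ $$\tilde e(A_n^* )=\frac1{(2\pi|k|)^s}\quad\text{if } k\neq0\text{ and } n\in[0,2|k|),$$ $$\tilde e(A_n^* )\le\frac{2}{(2\pi)^s}\,\frac1{(n-|k|)^s}\quad\text{if } n\ge\max(1,2|k|).$$ Furthermore, $$\tilde e(A_n^* )\le\left(\frac3{2\pi}\right)^s\frac{2}{(n+|k|)^s}\qquad\text{for all } n\ge1.$$
   Context: For $s\in\mathbb{N}=\{1,2,\dots\}$ let $H^s=\{f:[0,1]\to\mathbb{C} : f^{(s-1)}\text{ is absolutely continuous},\ f^{(s)}\in L_2([0,1])\}$ with inner product $$\langle f,g\rangle_s=\sum_{\ell=0}^{s-1}\int_0^1 f^{(\ell)}(x)\,dx\ \int_0^1\overline{g^{(\ell)}(x)}\,dx+\int_0^1 f^{(s)}(x)\,\overline{g^{(s)}(x)}\,dx$$ and norm $\|f\|_{H^s}=\langle f,f\rangle_s^{1/2}$. The periodic subspace is $\widetilde H^s=\{f\in H^s : f^{(\ell)}(0)=f^{(\ell)}(1)\text{ for }\ell=0,1,\dots,s-1\}$ with the same inner product. For $k\in\mathbb{Z}$, $I_k(f)=\int_0^1 f(x)\,e^{-2\pi i kx}\,dx$. For an algorithm $A:\widetilde H^s\to\mathbb{C}$ its worst case error is $\tilde e(A)=\sup\{|I_k(f)-A(f)| : f\in\widetilde H^s,\ \|f\|_{H^s}\le1\}$.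 For $n\ge1$, $A_n^{\rm QMC}(f)=\frac1n\sum_{j=1}^n f(j/n)\,e^{-2\pi i k j/n}$. For $n=0,1,\dots$ the algorithm $A_n^*$ on $\widetilde H^s$ is defined by $A_n^*(f)=0$ if $n=0$ or $n<2|k|$, and $A_n^*(f)=A_n^{\rm QMC}(f)$ if $n\ge\max(1,2|k|)$. *)

theory Defs
  imports "HOL-Analysis.Analysis"
begin

text \<open>
  A function on \<open>[0,1]\<close> is represented by a total function on the reals; no definition
  below depends on its values outside \<open>[0,1]\<close>.
\<close>

text \<open>
  The finite families of non-overlapping closed subintervals \<open>k = [Inf k, Sup k]\<close> of
  \<open>[a,b]\<close> are exactly the divisions of subsets \<open>t\<close> of \<open>[a,b]\<close>. The library constant
  \<open>absolutely_continuous\<close> is about measures.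
\<close>
definition abs_cont_fun_on :: "real \<Rightarrow> real \<Rightarrow> (real \<Rightarrow> complex) \<Rightarrow> bool" where
  "abs_cont_fun_on a b f \<longleftrightarrow>
     (\<forall>\<epsilon>>0. \<exists>\<delta>>0. \<forall>d t.
        d division_of t \<and> t \<subseteq> {a..b} \<and> (\<Sum>k\<in>d. Sup k - Inf k) < \<delta> \<longrightarrow>
        (\<Sum>k\<in>d. cmod (f (Sup k) - f (Inf k))) < \<epsilon>)"

definition L2_unit :: "(real \<Rightarrow> complex) set" where
  "L2_unit = {g. g \<in> borel_measurable (lebesgue_on {0..1}) \<and>
                 integrable (lebesgue_on {0..1}) (\<lambda>x. (cmod (g x))\<^sup>2)}"

text \<open>
  Derivatives at \<open>0\<close> and \<open>1\<close> are one-sided. The value is arbitrary wherever the derivative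
  does not exist.
\<close>
fun deriv_unit :: "nat \<Rightarrow> (real \<Rightarrow> complex) \<Rightarrow> real \<Rightarrow> complex" where
  "deriv_unit 0 f = f"
| "deriv_unit (Suc l) f = (\<lambda>x. vector_derivative (deriv_unit l f) (at x within {0..1}))"

text \<open>
  The derivatives of order at most \<open>s - 1\<close> exist everywhere on \<open>[0,1]\<close>, the one of order
  \<open>s\<close> almost everywhere. The latter already follows from absolute continuity; it is spelled
  out because \<open>deriv_unit s f\<close> is meaningful only where that derivative exists.
\<close>
definition sobolev :: "nat \<Rightarrow> (real \<Rightarrow> complex) set" where
  "sobolev s = {f.
     (\<forall>l < s - 1. deriv_unit l f differentiable_on {0..1}) \<and>
     abs_cont_fun_on 0 1 (deriv_unit (s - 1) f) \<and>
     (AE x in lebesgue_on {0..1}. deriv_unit (s - 1) f differentiable (at x within {0..1})) \<and>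
     deriv_unit s f \<in> L2_unit}"

definition sobolev_inner :: "nat \<Rightarrow> (real \<Rightarrow> complex) \<Rightarrow> (real \<Rightarrow> complex) \<Rightarrow> complex" where
  "sobolev_inner s f g =
     (\<Sum>l<s. (LINT x|lebesgue_on {0..1}. deriv_unit l f x) *
             (LINT x|lebesgue_on {0..1}. cnj (deriv_unit l g x))) +
     (LINT x|lebesgue_on {0..1}. deriv_unit s f x * cnj (deriv_unit s g x))"

definition sobolev_norm :: "nat \<Rightarrow> (real \<Rightarrow> complex) \<Rightarrow> real" where
  "sobolev_norm s f = sqrt (Re (sobolev_inner s f f))"

definition periodic_sobolev :: "nat \<Rightarrow> (real \<Rightarrow> complex) set" where
  "periodic_sobolev s = {f \<in> sobolev s. \<forall>l<s. deriv_unit l f 0 = deriv_unit l f 1}"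

definition fourier_int :: "int \<Rightarrow> (real \<Rightarrow> complex) \<Rightarrow> complex" where
  "fourier_int k f =
     (LINT x|lebesgue_on {0..1}. f x * exp (- 2 * of_real pi * \<i> * of_int k * of_real x))"

text \<open>Extended real valued, so that a bound on the error includes finiteness of the supremum.\<close>
definition periodic_wce :: "nat \<Rightarrow> int \<Rightarrow> ((real \<Rightarrow> complex) \<Rightarrow> complex) \<Rightarrow> ereal" where
  "periodic_wce s k A =
     (SUP f \<in> {f \<in> periodic_sobolev s. sobolev_norm s f \<le> 1}.
        ereal (cmod (fourier_int k f - A f)))"

definition QMC :: "int \<Rightarrow> nat \<Rightarrow> (real \<Rightarrow> complex) \<Rightarrow> complex" where
  "QMC k n f =
     1 / of_nat n *
     (\<Sum>j=1..n. f (real j / real n) *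
        exp (- 2 * of_real pi * \<i> * of_int k * of_nat j / of_nat n))"

definition A_star :: "int \<Rightarrow> nat \<Rightarrow> (real \<Rightarrow> complex) \<Rightarrow> complex" where
  "A_star k n f = (if n = 0 \<or> int n < 2 * \<bar>k\<bar> then 0 else QMC k n f)"

end

theory Submission
  imports Defs
begin

text \<open>
  Write \<open>c h\<close> for the Fourier coefficients of a function \<open>f\<close> in the unit ball of the periodic
  space. Integration by parts \<open>s\<close> times turns them into \<open>d h = (2 \<pi> i h) ^ s * c h\<close>, the
  coefficients of the derivative of order \<open>s\<close> (\<open>sobolev_fourier_int_top\<close>), and Bessel's
  inequality bounds the sum of \<open>\<bar>d h\<bar>\<^sup>2\<close> by \<open>1\<close> (\<open>sobolev_Bessel\<close>).

  Where the algorithm is zero, the error at \<open>f\<close> is \<open>\<bar>c k\<bar>\<close>. For \<open>k \<noteq> 0\<close> this is at most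
  \<open>1 / (2 \<pi> \<bar>k\<bar>) ^ s\<close>, and a multiple of the oscillation of frequency \<open>k\<close> attains the bound; for
  \<open>k = 0\<close> the mean value is one of the terms of the norm and the constant \<open>1\<close> is extremal.

  Where the algorithm is the equispaced rule, a frequency \<open>h\<close> is integrated as if it were \<open>k\<close> when
  \<open>n\<close> divides \<open>h - k\<close>, and to \<open>0\<close> otherwise (\<open>QMC_osc\<close>). So the error is the sum of the aliased
  coefficients \<open>c (k + m n)\<close>, \<open>m \<noteq> 0\<close>. By Cauchy-Schwarz against \<open>d\<close> it is at most the square root
  of the sum of \<open>1 / (2 \<pi> \<bar>k + m n\<bar>) ^ (2 s)\<close>. Because of \<open>\<bar>k + m n\<bar> \<ge> \<bar>m\<bar> (n - \<bar>k\<bar>)\<close> and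
  because the sum of \<open>1 / m\<^sup>2\<close> over all \<open>m \<noteq> 0\<close> is at most \<open>4\<close>, the root is at most
  \<open>2 / (2 \<pi> (n - \<bar>k\<bar>)) ^ s\<close> (\<open>alias_weights_le\<close>, \<open>QMC_error\<close>). The bound for all \<open>n \<ge> 1\<close> follows,
  since \<open>(n + \<bar>k\<bar>) / 3\<close> is at most \<open>n - \<bar>k\<bar>\<close> if \<open>n \<ge> 2 \<bar>k\<bar>\<close> and at most \<open>\<bar>k\<bar>\<close> otherwise.

  The analytic work is in two steps taken for granted above. Integrating by parts at the top
  order uses the fundamental theorem of calculus for absolutely continuous functions
  (\<open>abs_cont_fun_on_fundamental_theorem\<close>). Point evaluation of the Fourier series uses its
  absolute convergence, together with the fact that a continuous periodic function is determined
  by its Fourier coefficients (\<open>fourier_int_zero_imp_zero\<close>), a consequence of the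
  Stone-Weierstrass theorem on the circle.
\<close>

section \<open>Absolutely continuous functions\<close>

text \<open>
  The derivative is integrated in the sense of Henstock and Kurzweil, where the usual proof of the
  fundamental theorem tolerates an exceptional null set \<open>N\<close>: choose the gauge at the points of \<open>N\<close>
  so small that all intervals tagged there lie in an open set \<open>U\<close> of measure less than \<open>\<delta>\<close>.
  Absolute continuity bounds the total increment of \<open>F\<close> over those intervals, and redefining the
  derivative to be \<open>0\<close> on \<open>N\<close> removes their contribution to the Riemann sum.
\<close>

lemma abs_cont_fun_on_fundamental_theorem:
  fixes F \<phi> :: "real \<Rightarrow> complex"
  assumes "a < b" and ac: "abs_cont_fun_on a b F" and N: "negligible N"
    and deriv: "\<And>x. x \<in> {a..b} - N \<Longrightarrow> (F has_vector_derivative \<phi> x) (at x within {a..b})"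
  shows "(\<phi> has_integral (F b - F a)) {a..b}"
proof -
  define \<psi> where "\<psi> x = (if x \<in> N then 0 else \<phi> x)" for x
  have "(\<psi> has_integral (F b - F a)) {a..b}"
    unfolding has_integral_factor_content_real
  proof (intro allI impI)
    fix e :: real
    assume "e > 0"
    then have "e * (b - a) / 2 > 0"
      using \<open>a < b\<close> by simp
    \<comment> \<open>Half of the allowed error goes to the intervals tagged in \<open>N\<close>, half to the others.\<close>
    with ac obtain \<delta> where "\<delta> > 0" and \<delta>:
      "\<And>d t. d division_of t \<Longrightarrow> t \<subseteq> {a..b} \<Longrightarrow> (\<Sum>k\<in>d. Sup k - Inf k) < \<delta> \<Longrightarrow>
        (\<Sum>k\<in>d. cmod (F (Sup k) - F (Inf k))) < e * (b - a) / 2"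
      unfolding abs_cont_fun_on_def by meson
    have "N \<in> sets lebesgue"
      using N negligible_imp_sets by blast
    then obtain U where "open U" "N \<subseteq> U"
      and UN: "U - N \<in> lmeasurable" "emeasure lebesgue (U - N) < ennreal \<delta>"
      using sets_lebesgue_outer_open \<open>\<delta> > 0\<close> by blast
    have "measure lebesgue (U - N) < \<delta>"
      using UN \<open>\<delta> > 0\<close> by (simp add: emeasure_eq_measure2 ennreal_less_iff)
    moreover have "U = (U - N) \<union> N"
      using \<open>N \<subseteq> U\<close> by blast
    ultimately have U: "U \<in> lmeasurable" "measure lebesgue U < \<delta>"
      using UN N negligible_imp_measurable measure_negligible_finite_Union
      by (metis fmeasurable.Un, metis UN(1) measure_Un_null_set fmeasurableD negligible_iff_null_sets)
    have "\<exists>r>0. (x \<in> N \<longrightarrow> ball x r \<subseteq> U) \<and> (x \<in> {a..b} - N \<longrightarrow> (\<forall>y\<in>{a..b}. norm (y - x) < r \<longrightarrow>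
        norm (F y - F x - (y - x) *\<^sub>R \<phi> x) \<le> e / 2 * norm (y - x)))" for x
    proof (cases "x \<in> N")
      case True
      then show ?thesis
        using \<open>open U\<close> \<open>N \<subseteq> U\<close> open_contains_ball by auto
    next
      case False
      then show ?thesis
        using deriv[of x] half_gt_zero[OF \<open>e > 0\<close>]
        unfolding has_vector_derivative_def has_derivative_within_alt
        by (cases "x \<in> {a..b}") (blast, auto intro: zero_less_one)
    qed
    then obtain r where r: "\<And>x. 0 < r x" "\<And>x. x \<in> N \<Longrightarrow> ball x (r x) \<subseteq> U"
      "\<And>x y. x \<in> {a..b} - N \<Longrightarrow> y \<in> {a..b} \<Longrightarrow> norm (y - x) < r x \<Longrightarrow>
        norm (F y - F x - (y - x) *\<^sub>R \<phi> x) \<le> e / 2 * norm (y - x)"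
      by metis
    show "\<exists>d. gauge d \<and> (\<forall>p. p tagged_division_of {a..b} \<and> d fine p \<longrightarrow>
      norm ((\<Sum>(x, k)\<in>p. measure lborel k *\<^sub>R \<psi> x) - (F b - F a)) \<le> e * measure lborel {a..b})"
    proof (intro exI conjI allI impI; (elim conjE)?)
      show "gauge (\<lambda>x. ball x (r x))"
        using r(1) gauge_ball_dependent by blast
    next
      fix p
      assume p: "p tagged_division_of {a..b}" and fine: "(\<lambda>x. ball x (r x)) fine p"
      define g where "g = (\<lambda>(x, K). measure lborel K *\<^sub>R \<psi> x - (F (Sup K) - F (Inf K)))"
      have "finite p"
        using p by blast
      have interval: "\<exists>u v. K = {u..v} \<and> u \<le> v \<and> x \<in> {u..v} \<and> {u..v} \<subseteq> {a..b} \<and> {u..v} \<subseteq> ball x (r x)"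
        if xK: "(x, K) \<in> p" for x K
      proof -
        obtain u v where "K = {u..v}"
          using tagged_division_ofD(4)[OF p xK] by auto
        then show ?thesis
          using tagged_division_ofD(2,3)[OF p xK] fineD[OF fine xK] by auto
      qed
      define p1 p2 where "p1 = {q \<in> p. fst q \<in> N}" and "p2 = {q \<in> p. fst q \<notin> N}"
      have "p = p1 \<union> p2" "p1 \<inter> p2 = {}" "finite p1" "finite p2"
        using \<open>finite p\<close> by (auto simp: p1_def p2_def)
      have len: "(\<Sum>(x, K)\<in>p. measure lborel K) = b - a"
        using additive_content_tagged_division[of p a b] p \<open>a < b\<close> by simp
      have "norm (sum g p2) \<le> (\<Sum>(x, K)\<in>p2. e / 2 * measure lborel K)"
      proof (rule sum_norm_le, safe)
        fix x K
        assume "(x, K) \<in> p2"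
        then have xK: "(x, K) \<in> p" "x \<notin> N"
          by (auto simp: p2_def)
        then obtain u v where uv: "K = {u..v}" "u \<le> v" "x \<in> {u..v}" "{u..v} \<subseteq> {a..b}"
          "{u..v} \<subseteq> ball x (r x)"
          using interval by blast
        then have "u \<in> {u..v}" "v \<in> {u..v}"
          by auto
        then have "u \<in> ball x (r x)" "v \<in> ball x (r x)" "x \<in> {a..b} - N" "u \<in> {a..b}" "v \<in> {a..b}"
          using uv xK by blast+
        then have "norm (F u - F x - (u - x) *\<^sub>R \<phi> x) \<le> e / 2 * norm (u - x)"
          "norm (F v - F x - (v - x) *\<^sub>R \<phi> x) \<le> e / 2 * norm (v - x)"
          using r(3) by (auto simp: dist_norm norm_minus_commute)
        moreover have "g (x, K) = (F u - F x - (u - x) *\<^sub>R \<phi> x) - (F v - F x - (v - x) *\<^sub>R \<phi> x)"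
          using uv xK by (simp add: g_def \<psi>_def algebra_simps)
        ultimately have "norm (g (x, K)) \<le> e / 2 * norm (u - x) + e / 2 * norm (v - x)"
          using norm_triangle_ineq4[of "F u - F x - (u - x) *\<^sub>R \<phi> x" "F v - F x - (v - x) *\<^sub>R \<phi> x"]
          by simp
        also have "\<dots> = e / 2 * measure lborel K"
          using uv by (simp add: field_simps)
        finally show "norm (g (x, K)) \<le> e / 2 * measure lborel K" .
      qed
      also have "\<dots> \<le> (\<Sum>(x, K)\<in>p. e / 2 * measure lborel K)"
        using \<open>finite p\<close> \<open>e > 0\<close> by (intro sum_mono2) (auto simp: p2_def)
      also have "\<dots> = e / 2 * (b - a)"
        unfolding len[symmetric] by (simp add: sum_distrib_left case_prod_unfold)
      finally have g2: "norm (sum g p2) \<le> e / 2 * (b - a)" .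
      have p1: "p1 tagged_partial_division_of {a..b}"
        using p tagged_partial_division_subset[of p "{a..b}" p1]
        by (auto simp: tagged_division_of_def p1_def)
      define d where "d = snd ` p1"
      have d: "d division_of \<Union>d"
        using p1 partial_division_of_tagged_division d_def by blast
      have dK: "\<exists>u v. K = {u..v} \<and> u \<le> v \<and> {u..v} \<subseteq> {a..b} \<and> {u..v} \<subseteq> U" if K: "K \<in> d" for K
      proof -
        obtain x where x: "(x, K) \<in> p" "x \<in> N"
          using K by (auto simp: d_def p1_def)
        show ?thesis
          using interval[OF x(1)] r(2)[OF x(2)] by blast
      qed
      have "\<Union>d \<subseteq> {a..b}" "\<Union>d \<subseteq> U"
        using dK by blast+
      have "(\<Sum>K\<in>d. Sup K - Inf K) = (\<Sum>K\<in>d. measure lebesgue K)"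
      proof (rule sum.cong[OF refl])
        fix K assume "K \<in> d"
        then show "Sup K - Inf K = measure lebesgue K"
          using dK[of K] by auto
      qed
      also have "\<dots> = measure lebesgue (\<Union>d)"
        using content_division d by blast
      also have "\<dots> \<le> measure lebesgue U"
        using \<open>\<Union>d \<subseteq> U\<close> U lmeasurable_division[OF d] by (intro measure_mono_fmeasurable) auto
      finally have "(\<Sum>K\<in>d. Sup K - Inf K) < \<delta>"
        using U by simp
      then have small: "(\<Sum>K\<in>d. cmod (F (Sup K) - F (Inf K))) < e * (b - a) / 2"
        using \<delta> d \<open>\<Union>d \<subseteq> {a..b}\<close> by blast
      \<comment> \<open>\<open>Sup\<close> and \<open>Inf\<close> of the empty set are unspecified, and the summation rule below asks about it.\<close>
      define v where "v K = (if K = {} then 0 else cmod (F (Sup K) - F (Inf K)))" for K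
      have "(\<Sum>(x, K)\<in>p1. v K) = sum v d"
        unfolding d_def
      proof (rule sum.over_tagged_division_lemma[OF tagged_partial_division_of_Union_self[OF p1]])
        fix u w :: real
        assume "box u w = {}"
        then have "w < u \<or> u = w"
          by auto
        then show "v (cbox u w) = 0"
          by (auto simp: v_def)
      qed
      moreover have "(\<Sum>(x, K)\<in>p1. v K) = (\<Sum>(x, K)\<in>p1. cmod (F (Sup K) - F (Inf K)))"
        using interval by (intro sum.cong) (fastforce simp: v_def p1_def)+
      moreover have "sum v d = (\<Sum>K\<in>d. cmod (F (Sup K) - F (Inf K)))"
        using dK by (intro sum.cong) (fastforce simp: v_def)+
      moreover have "norm (sum g p1) \<le> (\<Sum>(x, K)\<in>p1. cmod (F (Sup K) - F (Inf K)))"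
        by (rule sum_norm_le) (auto simp: g_def p1_def \<psi>_def norm_minus_commute)
      ultimately have g1: "norm (sum g p1) \<le> e / 2 * (b - a)"
        using small by simp
      have "sum g p = (\<Sum>(x, k)\<in>p. measure lborel k *\<^sub>R \<psi> x) - (\<Sum>(x, k)\<in>p. F (Sup k) - F (Inf k))"
        by (simp add: g_def case_prod_unfold sum_subtractf)
      also have "(\<Sum>(x, k)\<in>p. F (Sup k) - F (Inf k)) = F b - F a"
        using additive_tagged_division_1 p \<open>a < b\<close> by (metis less_imp_le)
      finally have "norm ((\<Sum>(x, k)\<in>p. measure lborel k *\<^sub>R \<psi> x) - (F b - F a)) = norm (sum g p1 + sum g p2)"
        using sum.union_disjoint[OF \<open>finite p1\<close> \<open>finite p2\<close> \<open>p1 \<inter> p2 = {}\<close>, of g] \<open>p = p1 \<union> p2\<close> by simp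
      also have "\<dots> \<le> e / 2 * (b - a) + e / 2 * (b - a)"
        using norm_triangle_mono[OF g1 g2] .
      finally show "norm ((\<Sum>(x, k)\<in>p. measure lborel k *\<^sub>R \<psi> x) - (F b - F a)) \<le> e * measure lborel {a..b}"
        using \<open>a < b\<close> by simp
    qed
  qed
  then show ?thesis
    using has_integral_spike[OF N, of "{a..b}" \<phi> \<psi>] by (auto simp: \<psi>_def)
qed

lemma abs_cont_fun_on_imp_continuous_on:
  assumes "abs_cont_fun_on a b F"
  shows "continuous_on {a..b} F"
  unfolding continuous_on_iff
proof (intro ballI allI impI)
  fix x e :: real
  assume x: "x \<in> {a..b}" and "e > 0"
  then obtain \<delta> where "\<delta> > 0" and \<delta>:
    "\<And>d t. d division_of t \<Longrightarrow> t \<subseteq> {a..b} \<Longrightarrow> (\<Sum>k\<in>d. Sup k - Inf k) < \<delta> \<Longrightarrow>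
      (\<Sum>k\<in>d. cmod (F (Sup k) - F (Inf k))) < e"
    using assms unfolding abs_cont_fun_on_def by meson
  have "dist (F u) (F v) < e" if "u \<in> {a..b}" "v \<in> {a..b}" "u \<le> v" "v - u < \<delta>" for u v
    using \<delta>[of "{{u..v}}" "{u..v}"] division_of_self[of u v] that
    by (auto simp: dist_norm norm_minus_commute)
  then have "dist (F y) (F x) < e" if "y \<in> {a..b}" "dist y x < \<delta>" for y
    using x that by (cases "x \<le> y") (force simp: dist_real_def dist_commute)+
  with \<open>\<delta> > 0\<close> show "\<exists>d>0. \<forall>y\<in>{a..b}. dist y x < d \<longrightarrow> dist (F y) (F x) < e"
    by blast
qed

text \<open>
  Comparing increments is all that is needed to recognise Lipschitz functions, and products with
  bounded Lipschitz functions, as absolutely continuous.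
\<close>

lemma abs_cont_fun_on_dominated:
  assumes ac: "abs_cont_fun_on a b F"
    and dom: "\<And>u v. a \<le> u \<Longrightarrow> u \<le> v \<Longrightarrow> v \<le> b \<Longrightarrow> cmod (G v - G u) \<le> L * (v - u) + cmod (F v - F u)"
  shows "abs_cont_fun_on a b G"
  unfolding abs_cont_fun_on_def
proof (intro allI impI)
  fix e :: real
  assume "e > 0"
  then have "e / 2 > 0" by simp
  then obtain \<delta> where "\<delta> > 0" and \<delta>:
    "\<And>d t. d division_of t \<Longrightarrow> t \<subseteq> {a..b} \<Longrightarrow> (\<Sum>k\<in>d. Sup k - Inf k) < \<delta> \<Longrightarrow>
      (\<Sum>k\<in>d. cmod (F (Sup k) - F (Inf k))) < e / 2"
    using ac unfolding abs_cont_fun_on_def by meson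
  define \<eta> where "\<eta> = min \<delta> (e / (2 * (\<bar>L\<bar> + 1)))"
  have "\<eta> > 0"
    using \<open>\<delta> > 0\<close> \<open>e > 0\<close> by (simp add: \<eta>_def add_nonneg_pos)
  moreover have "(\<Sum>k\<in>d. cmod (G (Sup k) - G (Inf k))) < e"
    if d: "d division_of t" "t \<subseteq> {a..b}" "(\<Sum>k\<in>d. Sup k - Inf k) < \<eta>" for d t
  proof -
    have interval: "\<exists>u v. k = {u..v} \<and> u \<le> v \<and> a \<le> u \<and> v \<le> b" if k: "k \<in> d" for k
    proof -
      obtain u v where "k = {u..v}"
        using division_ofD(4)[OF d(1) k] by auto
      moreover have "k \<noteq> {}" "k \<subseteq> {a..b}"
        using division_ofD(2,3)[OF d(1) k] d(2) by auto
      ultimately show ?thesis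
        by auto
    qed
    have "cmod (G (Sup k) - G (Inf k)) \<le> (\<bar>L\<bar> + 1) * (Sup k - Inf k) + cmod (F (Sup k) - F (Inf k))"
      if k: "k \<in> d" for k
    proof -
      obtain u v where "k = {u..v}" "u \<le> v" "a \<le> u" "v \<le> b"
        using interval[OF k] by blast
      moreover have "L * (v - u) \<le> (\<bar>L\<bar> + 1) * (v - u)"
        using \<open>u \<le> v\<close> by (intro mult_right_mono) auto
      ultimately show ?thesis
        using dom[of u v] by simp
    qed
    then have "(\<Sum>k\<in>d. cmod (G (Sup k) - G (Inf k))) \<le>
      (\<Sum>k\<in>d. (\<bar>L\<bar> + 1) * (Sup k - Inf k) + cmod (F (Sup k) - F (Inf k)))"
      by (rule sum_mono)
    also have "\<dots> = (\<bar>L\<bar> + 1) * (\<Sum>k\<in>d. Sup k - Inf k) + (\<Sum>k\<in>d. cmod (F (Sup k) - F (Inf k)))"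
      by (simp add: sum.distrib sum_distrib_left)
    also have "\<dots> < (\<bar>L\<bar> + 1) * (e / (2 * (\<bar>L\<bar> + 1))) + e / 2"
      using d \<delta>[OF d(1,2)] by (intro add_strict_mono mult_strict_left_mono) (auto simp: \<eta>_def)
    also have "\<dots> = e"
    proof -
      have "\<bar>L\<bar> + 1 \<noteq> 0" by linarith
      then show ?thesis by (simp add: field_simps)
    qed
    finally show ?thesis .
  qed
  ultimately show "\<exists>\<delta>>0. \<forall>d t. d division_of t \<and> t \<subseteq> {a..b} \<and> (\<Sum>k\<in>d. Sup k - Inf k) < \<delta> \<longrightarrow>
    (\<Sum>k\<in>d. cmod (G (Sup k) - G (Inf k))) < e"
    by blast
qed

lemma abs_cont_fun_on_const: "abs_cont_fun_on a b (\<lambda>x. c)"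
  unfolding abs_cont_fun_on_def by (auto intro!: exI[of _ 1])

lemma Lipschitz_imp_abs_cont_fun_on:
  assumes "\<And>u v. a \<le> u \<Longrightarrow> u \<le> v \<Longrightarrow> v \<le> b \<Longrightarrow> cmod (G v - G u) \<le> L * (v - u)"
  shows "abs_cont_fun_on a b G"
  using assms by (intro abs_cont_fun_on_dominated[OF abs_cont_fun_on_const[of _ _ 0], of _ _ _ L]) simp

lemma abs_cont_fun_on_mult_Lipschitz:
  assumes ac: "abs_cont_fun_on a b F"
    and G: "\<And>u. a \<le> u \<Longrightarrow> u \<le> b \<Longrightarrow> cmod (G u) \<le> 1"
      "\<And>u v. a \<le> u \<Longrightarrow> u \<le> v \<Longrightarrow> v \<le> b \<Longrightarrow> cmod (G v - G u) \<le> L * (v - u)"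
  shows "abs_cont_fun_on a b (\<lambda>x. F x * G x)"
proof -
  have "compact (F ` {a..b})"
    using abs_cont_fun_on_imp_continuous_on[OF ac] compact_continuous_image by blast
  then obtain M where M: "\<And>x. x \<in> {a..b} \<Longrightarrow> cmod (F x) \<le> M"
    using compact_imp_bounded bounded_iff by (metis imageI)
  show ?thesis
  proof (rule abs_cont_fun_on_dominated[OF ac])
    fix u v
    assume uv: "a \<le> u" "u \<le> v" "v \<le> b"
    have "F v * G v - F u * G u = F v * (G v - G u) + (F v - F u) * G u"
      by (simp add: algebra_simps)
    then have "cmod (F v * G v - F u * G u) \<le> cmod (F v) * cmod (G v - G u) + cmod (F v - F u) * cmod (G u)"
      by (metis norm_mult norm_triangle_ineq)
    also have "\<dots> \<le> M * (L * (v - u)) + cmod (F v - F u) * 1"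
    proof (intro add_mono mult_mono mult_left_mono)
      show "0 \<le> M"
        using M[of v] uv norm_ge_zero order_trans by (metis atLeastAtMost_iff)
    qed (use M G uv in auto)
    finally show "cmod (F v * G v - F u * G u) \<le> M * L * (v - u) + cmod (F v - F u)"
      by simp
  qed
qed

section \<open>Fourier coefficients on the unit interval\<close>

abbreviation unit_lebesgue :: "real measure" where
  "unit_lebesgue \<equiv> lebesgue_on {0..1}"

definition osc :: "int \<Rightarrow> real \<Rightarrow> complex" where
  "osc h x = cis (2 * pi * of_int h * x)"

lemma norm_osc [simp]: "cmod (osc h x) = 1"
  by (simp add: osc_def)

lemma osc_zero [simp]: "osc 0 x = 1" "osc h 0 = 1"
  by (simp_all add: osc_def)

lemma osc_one [simp]: "osc h 1 = 1"
  using cis_multiple_2pi[of "of_int h"] by (simp add: osc_def)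

lemma osc_mult: "osc h x * osc k x = osc (h + k) x"
  by (simp add: osc_def cis_mult algebra_simps)

lemma cnj_osc: "cnj (osc h x) = osc (- h) x"
  by (simp add: osc_def cis_cnj)

lemma exp_eq_osc: "exp (- 2 * of_real pi * \<i> * of_int k * of_real x) = osc (- k) x"
  by (simp add: osc_def cis_conv_exp algebra_simps)

lemma osc_has_vector_derivative:
  "(osc h has_vector_derivative 2 * pi * \<i> * of_int h * osc h x) (at x within S)"
proof -
  define c where "c = 2 * pi * \<i> * of_int h"
  have osc: "osc h x = exp (c * of_real x)" for x
    unfolding osc_def cis_conv_exp c_def by (rule arg_cong[where f = exp]) simp
  have "((\<lambda>z. exp (c * z)) has_field_derivative c * exp (c * of_real x)) (at (of_real x))"
    by (auto intro!: derivative_eq_intros)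
  then have "((\<lambda>x. exp (c * of_real x)) has_vector_derivative c * exp (c * of_real x)) (at x within S)"
    by (rule has_vector_derivative_real_field)
  then show ?thesis
    unfolding osc[symmetric] unfolding c_def .
qed

lemma continuous_on_osc [continuous_intros]: "continuous_on S (osc h)"
  unfolding osc_def by (intro continuous_intros)

lemma osc_Lipschitz:
  assumes "u \<le> v"
  shows "cmod (osc h v - osc h u) \<le> 2 * pi * of_int \<bar>h\<bar> * (v - u)"
proof -
  have "norm (osc h v - osc h u) \<le> 2 * pi * of_int \<bar>h\<bar> * norm (v - u)"
  proof (rule differentiable_bound[of "{u..v}"])
    fix x
    show "(osc h has_derivative (\<lambda>t. t *\<^sub>R (2 * pi * \<i> * of_int h * osc h x))) (at x within {u..v})"
      using osc_has_vector_derivative unfolding has_vector_derivative_def .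
    show "onorm (\<lambda>t. t *\<^sub>R (2 * pi * \<i> * of_int h * osc h x)) \<le> 2 * pi * of_int \<bar>h\<bar>"
      by (rule onorm_le) (simp add: norm_mult)
  qed (use assms in auto)
  then show ?thesis
    using assms by simp
qed

lemma finite_measure_unit_lebesgue: "finite_measure unit_lebesgue"
  by (intro finite_measureI) (simp add: emeasure_restrict_space)

lemma continuous_imp_integrable_unit:
  fixes u :: "real \<Rightarrow> complex"
  assumes "continuous_on {0..1} u"
  shows "integrable unit_lebesgue u"
  using assms continuous_imp_integrable_real by blast

lemma integrable_mult_osc:
  assumes "integrable unit_lebesgue f"
  shows "integrable unit_lebesgue (\<lambda>x. f x * osc h x)"
proof (rule Bochner_Integration.integrable_bound[OF assms])
  show "(\<lambda>x. f x * osc h x) \<in> borel_measurable unit_lebesgue"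
    using assms continuous_imp_integrable_unit[OF continuous_on_osc, of h]
    by (intro borel_measurable_times) (auto dest: borel_measurable_integrable)
qed (simp add: norm_mult)

lemma L2_unit_integrable:
  assumes "g \<in> L2_unit"
  shows "integrable unit_lebesgue g"
proof (rule Bochner_Integration.integrable_bound)
  show "integrable unit_lebesgue (\<lambda>x. 1 + (cmod (g x))\<^sup>2)"
    using assms
    by (intro Bochner_Integration.integrable_add finite_measure.integrable_const
        finite_measure_unit_lebesgue) (simp add: L2_unit_def)
  show "AE x in unit_lebesgue. norm (g x) \<le> norm (1 + (cmod (g x))\<^sup>2)"
  proof (rule AE_I2)
    fix x
    have "0 \<le> (cmod (g x) - 1)\<^sup>2"
      by simp
    then have "2 * cmod (g x) \<le> 1 + (cmod (g x))\<^sup>2"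
      by (simp add: power2_eq_square algebra_simps)
    then have "cmod (g x) \<le> 1 + (cmod (g x))\<^sup>2"
      using norm_ge_zero[of "g x"] by linarith
    then show "norm (g x) \<le> norm (1 + (cmod (g x))\<^sup>2)"
      by simp
  qed
qed (use assms in \<open>auto simp: L2_unit_def\<close>)

lemma fourier_int_eq_osc: "fourier_int k f = (LINT x|unit_lebesgue. f x * osc (- k) x)"
  unfolding fourier_int_def exp_eq_osc ..

lemma has_integral_imp_LINT:
  fixes f :: "real \<Rightarrow> complex"
  assumes "integrable unit_lebesgue f" "(f has_integral I) {0..1}"
  shows "(LINT x|unit_lebesgue. f x) = I"
  using lebesgue_integral_eq_integral[OF assms(1)] assms(2) by (simp add: integral_unique)

lemma integral_osc: "(LINT x|unit_lebesgue. osc h x) = (if h = 0 then 1 else 0)"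
proof (cases "h = 0")
  case True
  then show ?thesis
    by (simp add: measure_restrict_space)
next
  case False
  have "((\<lambda>x. 2 * pi * \<i> * of_int h * osc h x) has_integral osc h 1 - osc h 0) {0..1}"
    by (intro fundamental_theorem_of_calculus osc_has_vector_derivative) simp
  moreover have "integrable unit_lebesgue (\<lambda>x. 2 * pi * \<i> * of_int h * osc h x)"
    by (intro continuous_imp_integrable_unit continuous_intros)
  ultimately have "(LINT x|unit_lebesgue. 2 * pi * \<i> * of_int h * osc h x) = 0"
    using has_integral_imp_LINT by fastforce
  with False show ?thesis
    by simp
qed

text \<open>
  Integration by parts: the product of \<open>F\<close> and the oscillation of frequency \<open>- h\<close> is absolutely
  continuous, so the integral of its derivative is its increment, which periodicity makes \<open>0\<close>.
\<close>

lemma fourier_int_deriv: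
  assumes ac: "abs_cont_fun_on 0 1 F" and N: "negligible N"
    and deriv: "\<And>x. x \<in> {0..1} - N \<Longrightarrow> (F has_vector_derivative \<phi> x) (at x within {0..1})"
    and \<phi>: "integrable unit_lebesgue \<phi>"
    and periodic: "F 0 = F 1"
  shows "fourier_int h \<phi> = 2 * pi * \<i> * of_int h * fourier_int h F"
proof -
  define c where "c = 2 * pi * \<i> * of_int h"
  have F: "integrable unit_lebesgue F"
    using ac abs_cont_fun_on_imp_continuous_on continuous_imp_integrable_unit by blast
  have "abs_cont_fun_on 0 1 (\<lambda>x. F x * osc (- h) x)"
    using ac osc_Lipschitz[of _ _ "- h"] by (intro abs_cont_fun_on_mult_Lipschitz) auto
  moreover have "((\<lambda>x. F x * osc (- h) x) has_vector_derivative
      \<phi> x * osc (- h) x - c * (F x * osc (- h) x)) (at x within {0..1})" if "x \<in> {0..1} - N" for x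
    using has_vector_derivative_mult[OF deriv[OF that] osc_has_vector_derivative[of "- h"]]
    by (simp add: c_def algebra_simps)
  ultimately have "((\<lambda>x. \<phi> x * osc (- h) x - c * (F x * osc (- h) x)) has_integral
      F 1 * osc (- h) 1 - F 0 * osc (- h) 0) {0..1}"
    by (intro abs_cont_fun_on_fundamental_theorem[OF _ _ N]) auto
  then have "(LINT x|unit_lebesgue. \<phi> x * osc (- h) x - c * (F x * osc (- h) x)) = 0"
    using integrable_mult_osc[OF F] integrable_mult_osc[OF \<phi>] periodic
    by (intro has_integral_imp_LINT) auto
  then show ?thesis
    using integrable_mult_osc[OF F] integrable_mult_osc[OF \<phi>]
    by (simp add: fourier_int_eq_osc c_def)
qed

lemma L2_unit_integrable_square:
  assumes "g \<in> L2_unit"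
  shows "integrable unit_lebesgue (\<lambda>x. (cmod (g x))\<^sup>2)"
  using assms by (simp add: L2_unit_def)

text \<open>
  The mean square distance from \<open>g\<close> to its partial Fourier sum \<open>p\<close> is non-negative. Expanding it,
  both mixed terms and the square of \<open>p\<close> integrate to the sum on the left-hand side.
\<close>

lemma Bessel_inequality:
  assumes g: "g \<in> L2_unit" and "finite H"
  shows "(\<Sum>h\<in>H. (cmod (fourier_int h g))\<^sup>2) \<le> (LINT x|unit_lebesgue. (cmod (g x))\<^sup>2)"
proof -
  define c where "c h = fourier_int h g" for h
  define p where "p x = (\<Sum>h\<in>H. c h * osc h x)" for x
  define S where "S = (\<Sum>h\<in>H. (cmod (c h))\<^sup>2)"
  define I where "I = (LINT x|unit_lebesgue. (cmod (g x))\<^sup>2)"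
  have "has_bochner_integral unit_lebesgue (\<lambda>x. g x * osc (- h) x) (c h)" for h
    unfolding c_def fourier_int_eq_osc
    by (intro has_bochner_integral_integrable integrable_mult_osc L2_unit_integrable g)
  then have "has_bochner_integral unit_lebesgue (\<lambda>x. \<Sum>h\<in>H. cnj (c h) * (g x * osc (- h) x))
      (\<Sum>h\<in>H. cnj (c h) * c h)"
    by (intro has_bochner_integral_sum has_bochner_integral_mult_right) auto
  moreover have "(\<Sum>h\<in>H. cnj (c h) * c h) = of_real S"
    unfolding S_def of_real_sum complex_norm_square by (simp add: mult.commute)
  moreover have "(\<Sum>h\<in>H. cnj (c h) * (g x * osc (- h) x)) = g x * cnj (p x)" for x
    by (simp add: p_def cnj_osc sum_distrib_left algebra_simps)
  ultimately have gp: "has_bochner_integral unit_lebesgue (\<lambda>x. g x * cnj (p x)) (of_real S)"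
    by simp
  have pg: "has_bochner_integral unit_lebesgue (\<lambda>x. p x * cnj (g x)) (of_real S)"
    using has_bochner_integral_cnj[OF gp] by (simp add: mult.commute)
  have "has_bochner_integral unit_lebesgue (osc h) (if h = 0 then 1 else 0)" for h
    using has_bochner_integral_integrable[OF continuous_imp_integrable_unit[OF continuous_on_osc]]
      integral_osc[of h] by metis
  then have "has_bochner_integral unit_lebesgue
      (\<lambda>x. \<Sum>h\<in>H. \<Sum>k\<in>H. c h * cnj (c k) * osc (h - k) x)
      (\<Sum>h\<in>H. \<Sum>k\<in>H. c h * cnj (c k) * (if h - k = 0 then 1 else 0))"
    by (intro has_bochner_integral_sum has_bochner_integral_mult_right)
  moreover have "(\<Sum>h\<in>H. \<Sum>k\<in>H. c h * cnj (c k) * osc (h - k) x) = p x * cnj (p x)" for x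
  proof -
    have "osc (h - k) x = osc h x * osc (- k) x" for h k
      using osc_mult[of h x "- k"] by simp
    then show ?thesis
      by (simp add: p_def cnj_osc sum_product mult_ac)
  qed
  moreover have "(\<Sum>h\<in>H. \<Sum>k\<in>H. c h * cnj (c k) * (if h - k = 0 then 1 else 0)) = of_real S"
    unfolding S_def of_real_sum complex_norm_square
    using \<open>finite H\<close> by (simp add: if_distrib cong: if_cong)
  ultimately have pp: "has_bochner_integral unit_lebesgue (\<lambda>x. p x * cnj (p x)) (of_real S)"
    by simp
  have gg: "has_bochner_integral unit_lebesgue (\<lambda>x. g x * cnj (g x)) (of_real I)"
    using has_bochner_integral_of_real[OF has_bochner_integral_integrable[OF L2_unit_integrable_square[OF g]],
        where ?'a = complex]
    unfolding I_def[symmetric] complex_norm_square .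
  have "has_bochner_integral unit_lebesgue
      (\<lambda>x. g x * cnj (g x) - g x * cnj (p x) - (p x * cnj (g x) - p x * cnj (p x)))
      (of_real I - of_real S - (of_real S - of_real S))"
    by (intro has_bochner_integral_diff gg gp pg pp)
  moreover have "g x * cnj (g x) - g x * cnj (p x) - (p x * cnj (g x) - p x * cnj (p x)) =
      complex_of_real ((cmod (g x - p x))\<^sup>2)" for x
    unfolding complex_norm_square by (simp add: algebra_simps)
  ultimately have "complex_of_real (LINT x|unit_lebesgue. (cmod (g x - p x))\<^sup>2) = of_real (I - S)"
    by (simp add: has_bochner_integral_integral_eq flip: integral_complex_of_real)
  then have "(LINT x|unit_lebesgue. (cmod (g x - p x))\<^sup>2) = I - S"
    using of_real_eq_iff by blast
  moreover have "(LINT x|unit_lebesgue. (cmod (g x - p x))\<^sup>2) \<ge> 0"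
    by (rule Bochner_Integration.integral_nonneg) simp
  ultimately show ?thesis
    by (simp add: I_def S_def c_def)
qed

section \<open>Uniqueness of Fourier coefficients\<close>

inductive trig_poly :: "(real \<Rightarrow> complex) \<Rightarrow> bool" where
  monomial: "trig_poly (\<lambda>x. a * osc h x)"
| add: "trig_poly p \<Longrightarrow> trig_poly q \<Longrightarrow> trig_poly (\<lambda>x. p x + q x)"

lemma trig_poly_monomial_mult:
  assumes "trig_poly q"
  shows "trig_poly (\<lambda>x. a * osc h x * q x)"
  using assms
proof induction
  case (monomial b k)
  have "a * osc h x * (b * osc k x) = a * b * osc (h + k) x" for x
    by (simp add: osc_mult[symmetric])
  then show ?case
    by (simp only: trig_poly.monomial)
next
  case (add p q)
  then show ?case
    using trig_poly.add by (simp add: distrib_left)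
qed

lemma trig_poly_mult:
  assumes "trig_poly p" "trig_poly q"
  shows "trig_poly (\<lambda>x. p x * q x)"
  using assms(1)
proof induction
  case (monomial a h)
  then show ?case
    using trig_poly_monomial_mult assms(2) by simp
next
  case (add p p')
  then show ?case
    using trig_poly.add by (simp add: distrib_right)
qed

lemma trig_poly_const: "trig_poly (\<lambda>x. a)"
  using trig_poly.monomial[of a 0] by simp

text \<open>
  Real and imaginary part of \<open>osc 1 x\<close> are combinations of \<open>osc 1 x\<close> and \<open>osc (- 1) x\<close>, so
  trigonometric polynomials are what polynomials in the coordinates become on the unit circle.
\<close>

lemma trig_poly_real_polynomial_function:
  assumes "real_polynomial_function q"
  shows "trig_poly (\<lambda>x. of_real (q (osc 1 x)))"
  using assms
proof induction
  case (linear f)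
  interpret bounded_linear f by fact
  have "of_real (f (osc 1 x)) = (f 1 / 2 + f \<i> / (2 * \<i>)) * osc 1 x + (f 1 / 2 - f \<i> / (2 * \<i>)) * osc (- 1) x" for x
  proof -
    have "osc 1 x = Re (osc 1 x) *\<^sub>R 1 + Im (osc 1 x) *\<^sub>R \<i>"
      by (simp add: complex_eq_iff)
    then have f: "f (osc 1 x) = Re (osc 1 x) * f 1 + Im (osc 1 x) * f \<i>"
      by (metis add real_scaleR_def scaleR)
    show ?thesis
      unfolding f cnj_osc[symmetric, of 1 x] by (simp add: complex_eq_iff field_simps)
  qed
  then show ?case
    using trig_poly.add[OF trig_poly.monomial trig_poly.monomial] by simp
next
  case (const c)
  then show ?case
    using trig_poly_const by simp
next
  case (add f g)
  then show ?case
    using trig_poly.add by simp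
next
  case (mult f g)
  then show ?case
    using trig_poly_mult by simp
qed

text \<open>
  The two values at the end points agree, so \<open>u\<close> descends to a continuous function on the unit
  circle, to which the Stone-Weierstrass theorem applies. Its continuity is
  an instance of the correspondence between homotopies of loops and of maps on the circle.
\<close>

lemma trig_poly_dense:
  assumes u: "continuous_on {0..1} u" "u 0 = u 1" and "e > 0"
  shows "\<exists>p. trig_poly p \<and> (\<forall>x\<in>{0..1}. cmod (u x - p x) < e)"
proof -
  define U where "U = u \<circ> (\<lambda>z. Arg2pi z / (2 * pi))"
  have "homotopic_loops UNIV u u"
    using u by (simp add: homotopic_loops_refl path_def pathstart_def pathfinish_def)
  then have "continuous_on (sphere 0 1) U"
    unfolding U_def
    using homotopic_with_imp_continuous[OF homotopic_loops_imp_homotopic_circlemaps] by blast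
  then obtain P where P: "polynomial_function P" "\<And>z. z \<in> sphere 0 1 \<Longrightarrow> cmod (U z - P z) < e"
    using Stone_Weierstrass_polynomial_function[of "sphere (0::complex) 1" U e] \<open>e > 0\<close> by auto
  have "u x = U (osc 1 x)" if "x \<in> {0..1}" for x
  proof (cases "x = 1")
    case True
    then show ?thesis
      using u Arg2pi_of_real[of 1] by (simp add: U_def)
  next
    case False
    then have "Arg2pi (osc 1 x) = 2 * pi * x"
      using that unfolding osc_def cis_conv_exp by (subst Arg2pi_exp) auto
    then show ?thesis
      by (simp add: U_def)
  qed
  then have "cmod (u x - P (osc 1 x)) < e" if "x \<in> {0..1}" for x
    using P(2)[of "osc 1 x"] that by simp
  moreover have "trig_poly (\<lambda>x. P (osc 1 x))"
  proof -
    have "real_polynomial_function (Re \<circ> P)" "real_polynomial_function (Im \<circ> P)"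
      using P(1) bounded_linear_Re bounded_linear_Im unfolding polynomial_function_def by blast+
    then have "trig_poly (\<lambda>x. of_real (Re (P (osc 1 x))) + \<i> * of_real (Im (P (osc 1 x))))"
      using trig_poly_real_polynomial_function trig_poly_mult[OF trig_poly_const] trig_poly.add by force
    then show ?thesis
      by (simp flip: complex_eq)
  qed
  ultimately show ?thesis
    by blast
qed

lemma continuous_on_trig_poly: "trig_poly p \<Longrightarrow> continuous_on S p"
  by (induction rule: trig_poly.induct) (auto intro!: continuous_intros)

lemma fourier_int_zero_imp_orthogonal:
  assumes "continuous_on {0..1} u" "\<And>h. fourier_int h u = 0" "trig_poly p"
  shows "(LINT x|unit_lebesgue. u x * p x) = 0"
  using assms(3)
proof induction
  case (monomial a h)
  have "(LINT x|unit_lebesgue. u x * (a * osc h x)) = (LINT x|unit_lebesgue. a * (u x * osc h x))"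
    by (simp add: algebra_simps)
  then show ?case
    using assms(2)[of "- h"] by (simp add: fourier_int_eq_osc)
next
  case (add p q)
  have "integrable unit_lebesgue (\<lambda>x. u x * p x)" "integrable unit_lebesgue (\<lambda>x. u x * q x)"
    by (intro continuous_imp_integrable_unit continuous_on_mult assms continuous_on_trig_poly add.hyps)+
  then show ?case
    using add by (simp add: distrib_left)
qed

text \<open>
  Such a function is orthogonal to all trigonometric polynomials, hence, approximating its
  conjugate uniformly by them, also to itself.
\<close>

lemma fourier_int_zero_imp_zero:
  assumes u: "continuous_on {0..1} u" "u 0 = u 1" and zero: "\<And>h. fourier_int h u = 0"
    and x: "x \<in> {0..1}"
  shows "u x = 0"
proof -
  define I where "I = (LINT x|unit_lebesgue. (cmod (u x))\<^sup>2)"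
  have "I \<le> e" if "e > 0" for e
  proof -
    define L where "L = (LINT x|unit_lebesgue. cmod (u x))"
    have "L \<ge> 0"
      unfolding L_def by (rule Bochner_Integration.integral_nonneg) simp
    have cnj_u: "continuous_on {0..1} (\<lambda>x. cnj (u x))" "cnj (u 0) = cnj (u 1)"
      using u by (auto intro!: continuous_intros)
    \<comment> \<open>Any positive accuracy \<open>r\<close> with \<open>r * L \<le> e\<close> serves; \<open>L\<close> itself may vanish.\<close>
    have "e / (L + 1) > 0"
      using \<open>e > 0\<close> \<open>L \<ge> 0\<close> by simp
    then obtain p where p: "trig_poly p" "\<And>x. x \<in> {0..1} \<Longrightarrow> cmod (cnj (u x) - p x) < e / (L + 1)"
      using trig_poly_dense[OF cnj_u] by blast
    have int: "integrable unit_lebesgue (\<lambda>x. u x * cnj (u x))" "integrable unit_lebesgue (\<lambda>x. u x * p x)"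
      by (intro continuous_imp_integrable_unit continuous_on_mult continuous_on_cnj u continuous_on_trig_poly p)+
    have "complex_of_real I = (LINT x|unit_lebesgue. u x * cnj (u x))"
      unfolding I_def integral_complex_of_real[symmetric] complex_norm_square ..
    also have "\<dots> = (LINT x|unit_lebesgue. u x * (cnj (u x) - p x))"
      using fourier_int_zero_imp_orthogonal[OF u(1) zero p(1)] int by (simp add: right_diff_distrib)
    finally have "\<bar>I\<bar> = cmod (LINT x|unit_lebesgue. u x * (cnj (u x) - p x))"
      by (metis norm_of_real)
    also have "\<dots> \<le> (LINT x|unit_lebesgue. e / (L + 1) * cmod (u x))"
    proof (rule Bochner_Integration.integral_norm_bound_integral)
      show "integrable unit_lebesgue (\<lambda>x. u x * (cnj (u x) - p x))"
        using int by (simp add: right_diff_distrib)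
      show "integrable unit_lebesgue (\<lambda>x. e / (L + 1) * cmod (u x))"
        using continuous_imp_integrable_unit[OF u(1)] by simp
      show "norm (u x * (cnj (u x) - p x)) \<le> e / (L + 1) * cmod (u x)" if "x \<in> space unit_lebesgue" for x
        using p(2)[of x] that unfolding norm_mult
        by (subst mult.commute, intro mult_right_mono) auto
    qed
    also have "\<dots> = e / (L + 1) * L"
      by (simp add: L_def)
    also have "\<dots> \<le> e"
      using \<open>e > 0\<close> \<open>L \<ge> 0\<close> by (simp add: field_simps)
    finally show ?thesis
      by simp
  qed
  moreover have "I \<ge> 0"
    unfolding I_def by (rule Bochner_Integration.integral_nonneg) simp
  ultimately have "I = 0"
    using field_le_epsilon[of I 0] by simp
  then have "\<forall>x\<in>{0..1}. (cmod (u x))\<^sup>2 = 0"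
    unfolding I_def using u
    by (subst (asm) integralL_eq_0_iff) (auto intro!: continuous_intros)
  then show ?thesis
    using x by simp
qed

section \<open>Pointwise convergence of Fourier series\<close>

text \<open>
  Pairing the frequencies \<open>m\<close> and \<open>- m\<close> makes the symmetric partial sums ordinary partial sums of
  a series that converges uniformly by the Weierstrass test. Its sum \<open>g\<close> is continuous, periodic
  and has the same Fourier coefficients as \<open>f\<close>, so the two functions agree.
\<close>

lemma fourier_series_converges:
  fixes f :: "real \<Rightarrow> complex"
  assumes f: "continuous_on {0..1} f" "f 0 = f 1"
    and summable: "summable (\<lambda>m. cmod (fourier_int (int m) f) + cmod (fourier_int (- int m) f))"
    and x: "x \<in> {0..1}"
  shows "(\<lambda>N. \<Sum>h\<in>{- int N<..<int N}. fourier_int h f * osc h x) \<longlonglongrightarrow> f x"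
proof -
  define c where "c h = fourier_int h f" for h
  define M where "M m = cmod (c (int m)) + cmod (c (- int m))" for m
  define t where "t m x = (if m = 0 then c 0 else c (int m) * osc (int m) x + c (- int m) * osc (- int m) x)"
    for m x
  define g where "g x = (\<Sum>m. t m x)" for x
  have M: "summable M" "\<And>m. M m \<ge> 0"
    using summable by (auto simp: M_def[abs_def] c_def)
  have t_le: "cmod (t m x) \<le> M m" for m x
    using norm_triangle_ineq[of "c (int m) * osc (int m) x" "c (- int m) * osc (- int m) x"]
    by (auto simp: t_def M_def norm_mult)
  have partial: "(\<Sum>m<N. t m x) = (\<Sum>h\<in>{- int N<..<int N}. c h * osc h x)" for N x
  proof (induction N)
    case (Suc N)
    show ?case
    proof (cases "N = 0")
      case True
      have "{- int (Suc 0)<..<int (Suc 0)} = {0}"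
        by auto
      then show ?thesis
        using True by (simp add: t_def)
    next
      case False
      have "{- int (Suc N)<..<int (Suc N)} = insert (int N) (insert (- int N) {- int N<..<int N})"
        by auto
      then show ?thesis
        using Suc False by (simp add: t_def)
    qed
  qed simp
  have unif: "uniform_limit {0..1} (\<lambda>N x. \<Sum>m<N. t m x) g sequentially"
    unfolding g_def by (rule Weierstrass_m_test) (use t_le M in auto)
  have partial_cont: "continuous_on {0..1} (\<lambda>x. \<Sum>m<N. t m x)" for N
    unfolding partial by (intro continuous_intros)
  have "t m 0 = t m 1" for m
    by (simp add: t_def)
  then have g: "continuous_on {0..1} g" "g 0 = g 1"
    using uniform_limit_theorem[OF _ unif] partial_cont by (auto simp: g_def)
  have "fourier_int h g = c h" for h
  proof -
    have "(\<lambda>N. LINT x|unit_lebesgue. (\<Sum>m<N. t m x) * osc (- h) x)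
        \<longlonglongrightarrow> (LINT x|unit_lebesgue. g x * osc (- h) x)"
    proof (rule integral_dominated_convergence)
      show "integrable unit_lebesgue (\<lambda>x. suminf M)"
        by (intro finite_measure.integrable_const finite_measure_unit_lebesgue)
      show "AE x in unit_lebesgue. (\<lambda>N. (\<Sum>m<N. t m x) * osc (- h) x) \<longlonglongrightarrow> g x * osc (- h) x"
        using tendsto_uniform_limitI[OF unif] by (intro AE_I2 tendsto_mult tendsto_const) auto
      show "AE x in unit_lebesgue. norm ((\<Sum>m<N. t m x) * osc (- h) x) \<le> suminf M" for N
      proof (rule AE_I2)
        fix x
        have "cmod (\<Sum>m<N. t m x) \<le> (\<Sum>m<N. M m)"
          using t_le by (intro sum_norm_le) auto
        also have "\<dots> \<le> suminf M"
          using M by (intro sum_le_suminf) auto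
        finally show "norm ((\<Sum>m<N. t m x) * osc (- h) x) \<le> suminf M"
          by (simp add: norm_mult)
      qed
      show "(\<lambda>x. g x * osc (- h) x) \<in> borel_measurable unit_lebesgue"
        using integrable_mult_osc[OF continuous_imp_integrable_unit[OF g(1)]]
        by (rule borel_measurable_integrable)
      show "(\<lambda>x. (\<Sum>m<N. t m x) * osc (- h) x) \<in> borel_measurable unit_lebesgue" for N
        using integrable_mult_osc[OF continuous_imp_integrable_unit[OF partial_cont]]
        by (rule borel_measurable_integrable)
    qed
    moreover have "(LINT x|unit_lebesgue. (\<Sum>m<N. t m x) * osc (- h) x) = c h" if "N > nat \<bar>h\<bar>" for N
    proof -
      have "(LINT x|unit_lebesgue. (\<Sum>m<N. t m x) * osc (- h) x) =
          (LINT x|unit_lebesgue. (\<Sum>k\<in>{- int N<..<int N}. c k * osc (k - h) x))"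
        using osc_mult[of _ _ "- h"] unfolding partial sum_distrib_right by (simp add: mult.assoc)
      also have "\<dots> = (\<Sum>k\<in>{- int N<..<int N}. c k * (LINT x|unit_lebesgue. osc (k - h) x))"
        using continuous_imp_integrable_unit[OF continuous_on_osc] by simp
      also have "\<dots> = (\<Sum>k\<in>{- int N<..<int N}. if k = h then c k else 0)"
        by (intro sum.cong) (auto simp: integral_osc)
      also have "\<dots> = c h"
      proof -
        have "- int N < h" "h < int N"
          using that by linarith+
        then show ?thesis
          by simp
      qed
      finally show ?thesis .
    qed
    then have "(\<lambda>N. LINT x|unit_lebesgue. (\<Sum>m<N. t m x) * osc (- h) x) \<longlonglongrightarrow> c h"
      by (intro tendsto_eventually eventually_mono[OF eventually_gt_at_top])
    ultimately show ?thesis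
      unfolding fourier_int_eq_osc using LIMSEQ_unique by blast
  qed
  then have "fourier_int h (\<lambda>x. f x - g x) = 0" for h
    using integrable_mult_osc[OF continuous_imp_integrable_unit[OF f(1)]]
      integrable_mult_osc[OF continuous_imp_integrable_unit[OF g(1)]]
    by (simp add: fourier_int_eq_osc c_def left_diff_distrib)
  then have "f x - g x = 0"
    using f g x by (intro fourier_int_zero_imp_zero[of "\<lambda>x. f x - g x"]) (auto intro!: continuous_intros)
  then show ?thesis
    using tendsto_uniform_limitI[OF unif x] unfolding partial c_def by simp
qed

section \<open>Fourier coefficients of periodic Sobolev functions\<close>

text \<open>
  Below the top order the next derivative exists everywhere and is continuous, so that the
  function is Lipschitz; at the top order absolute continuity is part of the definition of the
  space and the derivative exists outside a null set.
\<close>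

lemma sobolev_fourier_int_deriv:
  assumes f: "f \<in> periodic_sobolev s" and "l < s"
  shows "fourier_int h (deriv_unit (Suc l) f) = 2 * pi * \<i> * of_int h * fourier_int h (deriv_unit l f)"
    and sobolev_continuous: "continuous_on {0..1} (deriv_unit l f)"
proof -
  have diff: "\<And>l. l < s - 1 \<Longrightarrow> deriv_unit l f differentiable_on {0..1}"
    and ac: "abs_cont_fun_on 0 1 (deriv_unit (s - 1) f)"
    and ae: "AE x in unit_lebesgue. deriv_unit (s - 1) f differentiable (at x within {0..1})"
    and L2: "deriv_unit s f \<in> L2_unit"
    and periodic: "deriv_unit l f 0 = deriv_unit l f 1"
    using f \<open>l < s\<close> by (auto simp: periodic_sobolev_def sobolev_def)
  have cont: "continuous_on {0..1} (deriv_unit m f)" if "m < s" for m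
  proof (cases "m < s - 1")
    case True
    then show ?thesis
      using diff differentiable_imp_continuous_on by blast
  next
    case False
    then have "m = s - 1"
      using that by simp
    then show ?thesis
      using abs_cont_fun_on_imp_continuous_on[OF ac] by simp
  qed
  show "continuous_on {0..1} (deriv_unit l f)"
    using cont \<open>l < s\<close> .
  show "fourier_int h (deriv_unit (Suc l) f) = 2 * pi * \<i> * of_int h * fourier_int h (deriv_unit l f)"
  proof (cases "l = s - 1")
    case True
    obtain N where N: "negligible N"
      "{x. \<not> (x \<in> {0..1} \<longrightarrow> deriv_unit (s - 1) f differentiable (at x within {0..1}))} \<subseteq> N"
      using ae by (auto simp: AE_restrict_space_iff eventually_ae_filter_negligible)
    have "Suc l = s"
      using True \<open>l < s\<close> by simp
    show ?thesis
    proof (rule fourier_int_deriv[OF _ N(1) _ _ periodic])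
      show "abs_cont_fun_on 0 1 (deriv_unit l f)"
        using ac True by simp
      show "integrable unit_lebesgue (deriv_unit (Suc l) f)"
        using L2 \<open>Suc l = s\<close> L2_unit_integrable by simp
      show "(deriv_unit l f has_vector_derivative deriv_unit (Suc l) f x) (at x within {0..1})"
        if "x \<in> {0..1} - N" for x
        using that N(2) True by (auto simp: vector_derivative_works[symmetric])
    qed
  next
    case False
    then have "l < s - 1" "Suc l < s"
      using \<open>l < s\<close> by auto
    have deriv: "(deriv_unit l f has_vector_derivative deriv_unit (Suc l) f x) (at x within {0..1})"
      if "x \<in> {0..1}" for x
      using diff[OF \<open>l < s - 1\<close>] that by (auto simp: vector_derivative_works[symmetric] differentiable_on_def)
    have "compact (deriv_unit (Suc l) f ` {0..1})"
      using cont[OF \<open>Suc l < s\<close>] compact_continuous_image by blast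
    then obtain B where B: "\<And>x. x \<in> {0..1} \<Longrightarrow> cmod (deriv_unit (Suc l) f x) \<le> B"
      using compact_imp_bounded bounded_iff by (metis imageI)
    show ?thesis
    proof (rule fourier_int_deriv[OF _ negligible_empty _ _ periodic])
      show "abs_cont_fun_on 0 1 (deriv_unit l f)"
      proof (rule Lipschitz_imp_abs_cont_fun_on)
        fix u v :: real
        assume uv: "0 \<le> u" "u \<le> v" "v \<le> 1"
        have "norm (deriv_unit l f v - deriv_unit l f u) \<le> B * norm (v - u)"
        proof (rule differentiable_bound[of "{0..1}"])
          fix x :: real
          assume x: "x \<in> {0..1}"
          show "(deriv_unit l f has_derivative (\<lambda>t. t *\<^sub>R deriv_unit (Suc l) f x)) (at x within {0..1})"
            using deriv[OF x] unfolding has_vector_derivative_def .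
          show "onorm (\<lambda>t. t *\<^sub>R deriv_unit (Suc l) f x) \<le> B"
          proof (rule onorm_le)
            fix t :: real
            show "norm (t *\<^sub>R deriv_unit (Suc l) f x) \<le> B * norm t"
              using mult_right_mono[OF B[OF x] norm_ge_zero[of t]]
              by (simp only: norm_scaleR real_norm_def mult.commute)
          qed
        qed (use uv in auto)
        then show "cmod (deriv_unit l f v - deriv_unit l f u) \<le> B * (v - u)"
          using uv by simp
      qed
    qed (use deriv cont[OF \<open>Suc l < s\<close>] continuous_imp_integrable_unit in auto)
  qed
qed

lemma sobolev_fourier_int_top:
  assumes "f \<in> periodic_sobolev s"
  shows "fourier_int h (deriv_unit s f) = (2 * pi * \<i> * of_int h) ^ s * fourier_int h f"
proof -
  have "l \<le> s \<Longrightarrow> fourier_int h (deriv_unit l f) = (2 * pi * \<i> * of_int h) ^ l * fourier_int h f" for l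
  proof (induction l)
    case (Suc l)
    then show ?case
      using sobolev_fourier_int_deriv(1)[OF assms, where l = l and h = h] by (simp only: power_Suc mult.assoc)
  qed simp
  then show ?thesis
    by simp
qed

text \<open>
  The mean values in the inner product are Fourier coefficients of frequency \<open>0\<close>. Every summand is
  non-negative, so each of them is bounded by the squared norm.
\<close>

lemma Re_sobolev_inner:
  "Re (sobolev_inner s f f) =
    (\<Sum>l<s. (cmod (fourier_int 0 (deriv_unit l f)))\<^sup>2) + (LINT x|unit_lebesgue. (cmod (deriv_unit s f x))\<^sup>2)"
proof -
  have "fourier_int 0 u = (LINT x|unit_lebesgue. u x)" for u
    by (simp add: fourier_int_eq_osc)
  then have "sobolev_inner s f f = of_real
    ((\<Sum>l<s. (cmod (fourier_int 0 (deriv_unit l f)))\<^sup>2) + (LINT x|unit_lebesgue. (cmod (deriv_unit s f x))\<^sup>2))"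
    unfolding sobolev_inner_def of_real_add of_real_sum integral_complex_of_real[symmetric] complex_norm_square
    by simp
  then show ?thesis
    by simp
qed

lemma sobolev_unit_ball:
  assumes "sobolev_norm s f \<le> 1"
  shows "(LINT x|unit_lebesgue. (cmod (deriv_unit s f x))\<^sup>2) \<le> 1"
    and "s \<ge> 1 \<Longrightarrow> cmod (fourier_int 0 f) \<le> 1"
proof -
  have le: "(\<Sum>l<s. (cmod (fourier_int 0 (deriv_unit l f)))\<^sup>2) +
      (LINT x|unit_lebesgue. (cmod (deriv_unit s f x))\<^sup>2) \<le> 1"
    using assms by (simp add: sobolev_norm_def Re_sobolev_inner)
  moreover have "(\<Sum>l<s. (cmod (fourier_int 0 (deriv_unit l f)))\<^sup>2) \<ge> 0"
    by (simp add: sum_nonneg)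
  ultimately show "(LINT x|unit_lebesgue. (cmod (deriv_unit s f x))\<^sup>2) \<le> 1"
    by linarith
  assume "s \<ge> 1"
  then have "(cmod (fourier_int 0 (deriv_unit 0 f)))\<^sup>2 \<le> (\<Sum>l<s. (cmod (fourier_int 0 (deriv_unit l f)))\<^sup>2)"
    by (intro member_le_sum) auto
  moreover have "(LINT x|unit_lebesgue. (cmod (deriv_unit s f x))\<^sup>2) \<ge> 0"
    by (rule Bochner_Integration.integral_nonneg) simp
  ultimately have "(cmod (fourier_int 0 (deriv_unit 0 f)))\<^sup>2 \<le> 1"
    using le by linarith
  then show "cmod (fourier_int 0 f) \<le> 1"
    by (simp add: power_le_one_iff abs_square_le_1)
qed

lemma sobolev_fourier_int_norm:
  assumes "f \<in> periodic_sobolev s" "h \<noteq> 0"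
  shows "cmod (fourier_int h f) = cmod (fourier_int h (deriv_unit s f)) * (1 / (2 * pi * of_int \<bar>h\<bar>) ^ s)"
  using assms by (simp add: sobolev_fourier_int_top norm_mult norm_power)

lemma sobolev_Bessel:
  assumes "f \<in> periodic_sobolev s" "sobolev_norm s f \<le> 1" "finite H"
  shows "(\<Sum>h\<in>H. (cmod (fourier_int h (deriv_unit s f)))\<^sup>2) \<le> 1"
proof -
  have "deriv_unit s f \<in> L2_unit"
    using assms(1) by (simp add: periodic_sobolev_def sobolev_def)
  from Bessel_inequality[OF this assms(3)] sobolev_unit_ball(1)[OF assms(2)] show ?thesis
    by linarith
qed

text \<open>
  The coefficients are absolutely summable by the arithmetic-geometric mean inequality: with
  \<open>d\<close> as in the proof, the modulus of the coefficient of frequency \<open>m\<close> is at most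
  \<open>d m / \<bar>m\<bar> \<le> (d m)\<^sup>2 + 1 / m\<^sup>2\<close>, and \<open>d\<close> is square summable by Bessel's inequality.
\<close>

lemma sobolev_fourier_series_converges:
  assumes f: "f \<in> periodic_sobolev s" and norm: "sobolev_norm s f \<le> 1" and "s \<ge> 1"
    and x: "x \<in> {0..1}"
  shows "(\<lambda>N. \<Sum>h\<in>{- int N<..<int N}. fourier_int h f * osc h x) \<longlonglongrightarrow> f x"
proof (rule fourier_series_converges)
  show "continuous_on {0..1} f"
    using sobolev_continuous[OF f, of 0] \<open>s \<ge> 1\<close> by simp
  show "f 0 = f 1"
    using f \<open>s \<ge> 1\<close> unfolding periodic_sobolev_def by force
  define d where "d h = cmod (fourier_int h (deriv_unit s f))" for h
  have sum_d: "summable (\<lambda>m. (d (\<sigma> (int m)))\<^sup>2)" if "inj \<sigma>" for \<sigma>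
  proof (rule summableI_nonneg_bounded)
    fix N
    have "(\<Sum>m<N. (d (\<sigma> (int m)))\<^sup>2) = (\<Sum>h\<in>(\<lambda>m. \<sigma> (int m)) ` {..<N}. (d h)\<^sup>2)"
      by (subst sum.reindex) (auto intro!: inj_onI dest!: injD[OF that])
    also have "\<dots> \<le> 1"
      unfolding d_def by (intro sobolev_Bessel f norm) simp
    finally show "(\<Sum>m<N. (d (\<sigma> (int m)))\<^sup>2) \<le> 1" .
  qed simp
  have "summable (\<lambda>m. (d (int m))\<^sup>2 + (d (- int m))\<^sup>2 + 2 * inverse (real m ^ 2))"
    using sum_d[of "\<lambda>m. m"] sum_d[of uminus] inverse_power_summable[of 2, where 'a = real]
    by (intro summable_add summable_mult) (auto simp: inj_on_def)
  then show "summable (\<lambda>m. cmod (fourier_int (int m) f) + cmod (fourier_int (- int m) f))"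
  proof (rule summable_comparison_test')
    fix m :: nat
    assume "m \<ge> 1"
    have "cmod (fourier_int h f) \<le> (d h)\<^sup>2 + inverse (real m ^ 2)" if "\<bar>h\<bar> = int m" for h
    proof -
      have "real m \<le> 2 * pi * real m"
        using pi_gt3 by (simp add: mult_le_cancel_right1)
      also have "\<dots> \<le> (2 * pi * real m) ^ s"
      proof (rule self_le_power)
        show "1 \<le> 2 * pi * real m"
          using calculation \<open>m \<ge> 1\<close> by linarith
      qed (use \<open>s \<ge> 1\<close> in simp)
      finally have "1 / (2 * pi * real m) ^ s \<le> inverse (real m)"
        using \<open>m \<ge> 1\<close> by (simp add: field_simps)
      then have "d h * (1 / (2 * pi * real m) ^ s) \<le> d h * inverse (real m)"
        by (intro mult_left_mono) (simp_all add: d_def)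
      also have "\<dots> \<le> (d h)\<^sup>2 + (inverse (real m))\<^sup>2"
        using sum_squares_bound[of "d h" "inverse (real m)"] zero_le_power2[of "d h"]
          zero_le_power2[of "inverse (real m)"] by linarith
      also have "d h * (1 / (2 * pi * real m) ^ s) = cmod (fourier_int h f)"
        using sobolev_fourier_int_norm[OF f, of h] that \<open>m \<ge> 1\<close> by (simp add: d_def)
      finally show ?thesis
        by (simp add: power_inverse)
    qed
    from this[of "int m"] this[of "- int m"]
    show "norm (cmod (fourier_int (int m) f) + cmod (fourier_int (- int m) f)) \<le>
      (d (int m))\<^sup>2 + (d (- int m))\<^sup>2 + 2 * inverse (real m ^ 2)"
      by simp
  qed
qed (use x in auto)

section \<open>Aliasing error of the equispaced rule\<close>

lemma QMC_eq_osc: "QMC k n f = 1 / of_nat n * (\<Sum>j=1..n. f (real j / real n) * osc (- k) (real j / real n))"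
proof -
  have "exp (- 2 * of_real pi * \<i> * of_int k * of_nat j / of_nat n) = osc (- k) (real j / real n)" for j
    using exp_eq_osc[of k "real j / real n"] by simp
  then show ?thesis
    by (simp add: QMC_def)
qed

text \<open>
  The nodes turn the rule into an average of the powers of an \<open>n\<close>-th root of unity, which is \<open>1\<close>
  exactly if \<open>n\<close> divides \<open>h - k\<close>; otherwise the geometric sum vanishes.
\<close>

lemma QMC_osc:
  assumes "n \<ge> 1"
  shows "QMC k n (osc h) = (if int n dvd h - k then 1 else 0)"
proof -
  define z where "z = osc (h - k) (1 / real n)"
  have power: "z ^ j = osc (h - k) (real j / real n)" for j
    unfolding z_def osc_def Complex.DeMoivre by (rule arg_cong[where f = cis]) simp
  have "QMC k n (osc h) = 1 / of_nat n * (\<Sum>j=1..n. z ^ j)"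
    unfolding QMC_eq_osc osc_mult power by simp
  also have "\<dots> = (if int n dvd h - k then 1 else 0)"
  proof (cases "int n dvd h - k")
    case True
    then obtain m where "h - k = int n * m"
      by blast
    then have "2 * pi * of_int (h - k) * (1 / real n) = 2 * pi * of_int m * 1"
      using assms by simp
    then have "z = osc m 1"
      unfolding z_def osc_def by (rule arg_cong)
    then show ?thesis
      using True assms by simp
  next
    case False
    have "z \<noteq> 1"
    proof
      assume "z = 1"
      then have "exp (\<i> * of_real (2 * pi * of_int (h - k) * (1 / real n))) = 1"
        by (simp only: z_def osc_def cis_conv_exp)
      then obtain m :: int where "2 * pi * of_int (h - k) * (1 / real n) = of_int (2 * m) * pi"
        unfolding exp_eq_1 by auto
      then have "(2 * pi) * real_of_int (h - k) = (2 * pi) * real_of_int (m * int n)"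
        using assms by (simp add: field_simps)
      then have "real_of_int (h - k) = real_of_int (m * int n)"
        unfolding mult_cancel_left by simp
      then have "h - k = m * int n"
        by (simp only: of_int_eq_iff)
      then show False
        using False by simp
    qed
    moreover have "z ^ n = 1"
      using assms by (simp add: power)
    ultimately show ?thesis
      using False by (simp add: sum.atLeast1_atMost_eq geometric_sum flip: sum_distrib_left)
  qed
  finally show ?thesis .
qed

lemma QMC_sum: "QMC k n (\<lambda>x. \<Sum>h\<in>H. c h * f h x) = (\<Sum>h\<in>H. c h * QMC k n (f h))"
  unfolding QMC_def sum_distrib_left sum_distrib_right
  by (subst sum.swap) (simp add: mult_ac)

text \<open>
  Telescoping with \<open>1 / (j + 1)\<^sup>2 \<le> 1 / j - 1 / (j + 1)\<close> is enough; the sharp value \<open>\<pi>\<^sup>2 / 6\<close> would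
  only improve the constant \<open>2\<close> of the final bound.
\<close>

lemma sum_inverse_squares_le_2: "(\<Sum>j=1..L. 1 / (real j)\<^sup>2) \<le> 2"
proof -
  have "(\<Sum>j=1..Suc L. 1 / (real j)\<^sup>2) \<le> 2 - 1 / real (Suc L)" for L
  proof (induction L)
    case (Suc L)
    have "1 / (real (Suc (Suc L)))\<^sup>2 \<le> 1 / (real (Suc L) * real (Suc (Suc L)))"
      by (intro divide_left_mono) (auto simp: power2_eq_square)
    also have "\<dots> = 1 / real (Suc L) - 1 / real (Suc (Suc L))"
      by (simp add: field_simps)
    finally show ?case
      using Suc by simp
  qed simp
  then have "(\<Sum>j=1..Suc L. 1 / (real j)\<^sup>2) \<le> 2" for L
    by (rule order_trans) simp
  then show ?thesis
    by (cases L) auto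
qed

lemma sum_inverse_squares_int_le_4:
  fixes B :: "int set"
  assumes "finite B" "0 \<notin> B"
  shows "(\<Sum>m\<in>B. 1 / (of_int m)\<^sup>2) \<le> (4 :: real)"
proof -
  define L where "L = nat (Max (insert 0 (abs ` B)))"
  have "\<bar>m\<bar> \<le> int L" if "m \<in> B" for m
    using that assms by (simp add: L_def)
  note L = this
  have "B \<subseteq> int ` {1..L} \<union> (\<lambda>j. - int j) ` {1..L}"
  proof
    fix m
    assume "m \<in> B"
    then have "m \<noteq> 0" "\<bar>m\<bar> \<le> int L"
      using L assms(2) by auto
    then have "nat \<bar>m\<bar> \<in> {1..L}" "m = int (nat \<bar>m\<bar>) \<or> m = - int (nat \<bar>m\<bar>)"
      by auto
    then show "m \<in> int ` {1..L} \<union> (\<lambda>j. - int j) ` {1..L}"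
      by blast
  qed
  then have "(\<Sum>m\<in>B. 1 / (of_int m)\<^sup>2) \<le> (\<Sum>m\<in>int ` {1..L} \<union> (\<lambda>j. - int j) ` {1..L}. 1 / (of_int m)\<^sup>2 :: real)"
    by (intro sum_mono2) auto
  also have "\<dots> \<le> (\<Sum>m\<in>int ` {1..L}. 1 / (of_int m)\<^sup>2) + (\<Sum>m\<in>(\<lambda>j. - int j) ` {1..L}. 1 / (of_int m)\<^sup>2)"
    by (subst sum.union_disjoint) auto
  also have "\<dots> = (\<Sum>j=1..L. 1 / (real j)\<^sup>2) + (\<Sum>j=1..L. 1 / (real j)\<^sup>2)"
    by (simp add: sum.reindex inj_on_def)
  finally show ?thesis
    using sum_inverse_squares_le_2[of L] by linarith
qed

text \<open>
  Since \<open>h = k + m n\<close> with \<open>m \<noteq> 0\<close>, the triangle inequality gives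
  \<open>\<bar>h\<bar> \<ge> \<bar>m\<bar> n - \<bar>k\<bar> \<ge> \<bar>m\<bar> (n - \<bar>k\<bar>)\<close>. Each weight is therefore at most the weight at
  \<open>n - \<bar>k\<bar>\<close> divided by \<open>m ^ (2 s) \<ge> m\<^sup>2\<close>.
\<close>

lemma alias_weights_le:
  assumes "n \<ge> 1" "2 * \<bar>k\<bar> \<le> int n" "s \<ge> 1"
    and H: "finite H" "\<And>h. h \<in> H \<Longrightarrow> int n dvd h - k \<and> h \<noteq> k"
  shows "(\<Sum>h\<in>H. (1 / (2 * pi * of_int \<bar>h\<bar>) ^ s)\<^sup>2) \<le> (2 / (2 * pi * (real n - of_int \<bar>k\<bar>)) ^ s)\<^sup>2"
proof -
  define D where "D = real n - of_int \<bar>k\<bar>"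
  define w where "w = 1 / (2 * pi * D) ^ s"
  have "2 * \<bar>real_of_int k\<bar> \<le> real n"
    using assms(2) by linarith
  then have "D > 0"
    using assms(1) unfolding D_def by (cases "k = 0") auto
  define m where "m h = (h - k) div int n" for h
  have m: "h = k + m h * int n" "m h \<noteq> 0" if "h \<in> H" for h
    using H(2)[OF that] \<open>n \<ge> 1\<close> by (auto simp: m_def)
  have "(1 / (2 * pi * of_int \<bar>h\<bar>) ^ s)\<^sup>2 \<le> w\<^sup>2 * (1 / (of_int (m h))\<^sup>2)" if "h \<in> H" for h
  proof -
    define a where "a = real_of_int \<bar>m h\<bar>"
    have "a \<ge> 1"
      using m(2)[OF that] by (simp add: a_def)
    have "a * D \<le> a * real n - of_int \<bar>k\<bar>"
      using \<open>a \<ge> 1\<close> mult_right_mono[of 1 a "of_int \<bar>k\<bar>"] by (simp add: D_def algebra_simps)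
    also have "\<dots> = \<bar>real_of_int (m h * int n)\<bar> - \<bar>real_of_int k\<bar>"
      by (simp add: a_def abs_mult)
    also have "\<dots> \<le> \<bar>real_of_int (k + m h * int n)\<bar>"
      by simp
    also have "\<dots> = of_int \<bar>h\<bar>"
      using m(1)[OF that] by simp
    finally have h: "a * D \<le> of_int \<bar>h\<bar>" .
    have "a * D > 0"
      using \<open>a \<ge> 1\<close> \<open>D > 0\<close> by simp
    with h have h_pos: "0 < real_of_int \<bar>h\<bar>"
      by (rule order_less_le_trans[rotated])
    have "a * (2 * pi * D) ^ s \<le> a ^ s * (2 * pi * D) ^ s"
      using \<open>a \<ge> 1\<close> \<open>s \<ge> 1\<close> \<open>D > 0\<close> by (intro mult_right_mono self_le_power) auto
    also have "\<dots> = (2 * pi * (a * D)) ^ s"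
      by (simp add: power_mult_distrib)
    also have "\<dots> \<le> (2 * pi * of_int \<bar>h\<bar>) ^ s"
      using h \<open>a \<ge> 1\<close> \<open>D > 0\<close> by (intro power_mono mult_left_mono) auto
    finally have "1 / (2 * pi * of_int \<bar>h\<bar>) ^ s \<le> 1 / (a * (2 * pi * D) ^ s)"
      using \<open>a \<ge> 1\<close> \<open>D > 0\<close> h_pos
      by (intro divide_left_mono mult_pos_pos zero_less_power) (auto simp del: of_int_abs)
    also have "\<dots> = w * (1 / a)"
      by (simp add: w_def)
    finally have "(1 / (2 * pi * of_int \<bar>h\<bar>) ^ s)\<^sup>2 \<le> (w * (1 / a))\<^sup>2"
      by (intro power_mono) auto
    also have "\<dots> = w\<^sup>2 * (1 / (of_int (m h))\<^sup>2)"
      by (simp add: a_def power_mult_distrib power_divide)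
    finally show ?thesis .
  qed
  then have "(\<Sum>h\<in>H. (1 / (2 * pi * of_int \<bar>h\<bar>) ^ s)\<^sup>2) \<le> w\<^sup>2 * (\<Sum>h\<in>H. 1 / (of_int (m h))\<^sup>2)"
    unfolding sum_distrib_left by (rule sum_mono)
  also have "(\<Sum>h\<in>H. 1 / (real_of_int (m h))\<^sup>2) = (\<Sum>i\<in>m ` H. 1 / (of_int i)\<^sup>2)"
    using m(1) by (subst sum.reindex) (auto intro!: inj_onI, metis)
  also have "w\<^sup>2 * \<dots> \<le> w\<^sup>2 * 4"
    using m(2) H(1) by (intro mult_left_mono sum_inverse_squares_int_le_4) auto
  finally show ?thesis
    by (simp add: w_def D_def power_divide)
qed

text \<open>
  The estimate is proved for the partial Fourier sums \<open>F N\<close> in place of \<open>f\<close> inside the rule, with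
  the exact integral of \<open>f\<close> kept, and passes to the limit at the finitely many nodes. As soon as
  \<open>N > \<bar>k\<bar>\<close>, frequency \<open>k\<close> is integrated exactly and only its aliases \<open>H\<close> remain.
\<close>

lemma QMC_error:
  assumes f: "f \<in> periodic_sobolev s" and norm: "sobolev_norm s f \<le> 1" and "s \<ge> 1"
    and n: "n \<ge> 1" "2 * \<bar>k\<bar> \<le> int n"
  shows "cmod (fourier_int k f - QMC k n f) \<le> 2 / (2 * pi * (real n - of_int \<bar>k\<bar>)) ^ s"
proof -
  define c where "c h = fourier_int h f" for h
  define F where "F N x = (\<Sum>h\<in>{- int N<..<int N}. c h * osc h x)" for N x
  define b where "b = 2 / (2 * pi * (real n - of_int \<bar>k\<bar>)) ^ s"
  have "real_of_int \<bar>k\<bar> \<le> real n"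
    using n(2) by linarith
  then have "b \<ge> 0"
    by (simp add: b_def)
  have bound: "cmod (c k - QMC k n (F N)) \<le> b" if "N > nat \<bar>k\<bar>" for N
  proof -
    define H where "H = {h \<in> {- int N<..<int N}. int n dvd h - k \<and> h \<noteq> k}"
    have "finite H"
      by (rule finite_subset[of _ "{- int N<..<int N}"]) (auto simp: H_def)
    \<comment> \<open>Frequency \<open>0\<close>, which the derivative does not see, is no alias of \<open>k\<close>, because \<open>n > \<bar>k\<bar>\<close>.\<close>
    have nonzero: "h \<noteq> 0" if "h \<in> H" for h
    proof
      assume "h = 0"
      then have "int n dvd k" "k \<noteq> 0"
        using that by (auto simp: H_def)
      then have "int n \<le> \<bar>k\<bar>"
        using zdvd_imp_le[of "int n" "\<bar>k\<bar>"] by simp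
      then show False
        using n(2) \<open>k \<noteq> 0\<close> by simp
    qed
    have "QMC k n (F N) = (\<Sum>h\<in>{- int N<..<int N}. if int n dvd h - k then c h else 0)"
      unfolding F_def[abs_def] QMC_sum QMC_osc[OF n(1)] by (intro sum.cong) auto
    also have "\<dots> = (\<Sum>h\<in>{h \<in> {- int N<..<int N}. int n dvd h - k}. c h)"
      by (rule sum.inter_filter[symmetric]) simp
    also have "{h \<in> {- int N<..<int N}. int n dvd h - k} = insert k H"
      using that by (auto simp: H_def)
    also have "(\<Sum>h\<in>insert k H. c h) = c k + (\<Sum>h\<in>H. c h)"
      by (rule sum.insert[OF \<open>finite H\<close>]) (simp add: H_def)
    finally have "cmod (c k - QMC k n (F N)) = cmod (\<Sum>h\<in>H. c h)"
      by (simp add: norm_minus_commute)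
    also have "\<dots> \<le> (\<Sum>h\<in>H. \<bar>cmod (fourier_int h (deriv_unit s f))\<bar> * \<bar>1 / (2 * pi * of_int \<bar>h\<bar>) ^ s\<bar>)"
      using sobolev_fourier_int_norm[OF f] nonzero by (intro sum_norm_le) (simp add: c_def)
    also have "\<dots> \<le> L2_set (\<lambda>h. cmod (fourier_int h (deriv_unit s f))) H *
        L2_set (\<lambda>h. 1 / (2 * pi * of_int \<bar>h\<bar>) ^ s) H"
      by (rule L2_set_mult_ineq)
    also have "\<dots> \<le> 1 * b"
    proof (intro mult_mono)
      show "L2_set (\<lambda>h. cmod (fourier_int h (deriv_unit s f))) H \<le> 1"
        unfolding L2_set_def using sobolev_Bessel[OF f norm \<open>finite H\<close>] by simp
      show "L2_set (\<lambda>h. 1 / (2 * pi * of_int \<bar>h\<bar>) ^ s) H \<le> b"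
        unfolding L2_set_def b_def
        using alias_weights_le[OF n \<open>s \<ge> 1\<close> \<open>finite H\<close>] \<open>b \<ge> 0\<close>
        by (intro real_le_lsqrt) (auto simp: H_def b_def sum_nonneg)
    qed (auto simp: L2_set_nonneg)
    finally show ?thesis
      by simp
  qed
  have "(\<lambda>N. F N (real j / real n)) \<longlonglongrightarrow> f (real j / real n)" if "j \<in> {1..n}" for j
    unfolding F_def c_def using that n(1)
    by (intro sobolev_fourier_series_converges[OF f norm \<open>s \<ge> 1\<close>]) auto
  then have "(\<lambda>N. QMC k n (F N)) \<longlonglongrightarrow> QMC k n f"
    unfolding QMC_def by (intro tendsto_intros) auto
  then have "(\<lambda>N. cmod (c k - QMC k n (F N))) \<longlonglongrightarrow> cmod (c k - QMC k n f)"
    by (intro tendsto_intros)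
  then have "cmod (c k - QMC k n f) \<le> b"
    by (rule LIMSEQ_le_const2) (use bound in \<open>auto intro!: exI[of _ "Suc (nat \<bar>k\<bar>)"]\<close>)
  then show ?thesis
    by (simp add: c_def b_def)
qed

section \<open>Extremal functions and worst case errors\<close>

lemma fourier_int_norm_le:
  assumes f: "f \<in> periodic_sobolev s" and norm: "sobolev_norm s f \<le> 1" and "k \<noteq> 0"
  shows "cmod (fourier_int k f) \<le> 1 / (2 * pi * of_int \<bar>k\<bar>) ^ s"
proof -
  have "(cmod (fourier_int k (deriv_unit s f)))\<^sup>2 \<le> 1"
    using sobolev_Bessel[OF f norm, of "{k}"] by simp
  then have "cmod (fourier_int k (deriv_unit s f)) \<le> 1"
    by (simp add: power_le_one_iff abs_square_le_1)
  then have "cmod (fourier_int k (deriv_unit s f)) * (1 / (2 * pi * of_int \<bar>k\<bar>) ^ s) \<le>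
      1 * (1 / (2 * pi * of_int \<bar>k\<bar>) ^ s)"
    by (intro mult_right_mono) auto
  then show ?thesis
    using sobolev_fourier_int_norm[OF f \<open>k \<noteq> 0\<close>] by simp
qed

text \<open>
  Both claims concern points of \<open>{0..1}\<close> only, since elsewhere \<open>deriv_unit\<close> differentiates along a
  set that does not accumulate at the point. The first one is proved by induction on the order,
  the second is the induction step in the form needed for differentiability.
\<close>

lemma deriv_unit_osc:
  assumes "x \<in> {0..1}"
  shows "deriv_unit l (\<lambda>x. a * osc k x) x = a * (2 * pi * \<i> * of_int k) ^ l * osc k x"
    and deriv_unit_osc_has_vector_derivative: "(deriv_unit l (\<lambda>x. a * osc k x) has_vector_derivative
      a * (2 * pi * \<i> * of_int k) ^ Suc l * osc k x) (at x within {0..1})"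
proof -
  define c where "c = 2 * pi * \<i> * of_int k"
  have deriv: "((\<lambda>x. a * c ^ l * osc k x) has_vector_derivative a * c ^ Suc l * osc k x) (at x within {0..1})"
    for l x
  proof -
    have "((\<lambda>x. a * c ^ l * osc k x) has_vector_derivative a * c ^ l * (c * osc k x)) (at x within {0..1})"
      using osc_has_vector_derivative[of k x "{0..1}"] unfolding c_def[symmetric]
      by (rule has_vector_derivative_mult_right)
    then show ?thesis
      by (simp add: mult_ac)
  qed
  have eq: "deriv_unit l (\<lambda>x. a * osc k x) x = a * c ^ l * osc k x" if "x \<in> {0..1}" for l x
    using that
  proof (induction l arbitrary: x)
    case (Suc l)
    have "(deriv_unit l (\<lambda>x. a * osc k x) has_vector_derivative a * c ^ Suc l * osc k x) (at x within {0..1})"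
      using Suc by (intro has_vector_derivative_transform[OF _ _ deriv]) auto
    then have "vector_derivative (deriv_unit l (\<lambda>x. a * osc k x)) (at x within {0..1}) = a * c ^ Suc l * osc k x"
      using Suc.prems by (intro vector_derivative_within_closed_interval) auto
    then show ?case
      by simp
  qed simp
  show "deriv_unit l (\<lambda>x. a * osc k x) x = a * (2 * pi * \<i> * of_int k) ^ l * osc k x"
    using eq[OF assms] unfolding c_def .
  have "(deriv_unit l (\<lambda>x. a * osc k x) has_vector_derivative a * c ^ Suc l * osc k x) (at x within {0..1})"
    using eq assms by (intro has_vector_derivative_transform[OF _ _ deriv]) auto
  then show "(deriv_unit l (\<lambda>x. a * osc k x) has_vector_derivative
      a * (2 * pi * \<i> * of_int k) ^ Suc l * osc k x) (at x within {0..1})"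
    unfolding c_def .
qed

lemma osc_in_periodic_sobolev: "(\<lambda>x. a * osc k x) \<in> periodic_sobolev s"
proof -
  define f where "f = (\<lambda>x. a * osc k x)"
  define C where "C l = a * (2 * pi * \<i> * of_int k) ^ l" for l
  have eq: "deriv_unit l f x = C l * osc k x" if "x \<in> {0..1}" for l x
    using deriv_unit_osc[OF that] by (simp add: f_def C_def)
  have diff: "deriv_unit l f differentiable (at x within {0..1})" if "x \<in> {0..1}" for l x
    using deriv_unit_osc_has_vector_derivative[OF that] unfolding f_def by (rule differentiableI_vector)
  have "abs_cont_fun_on 0 1 (deriv_unit (s - 1) f)"
  proof (rule Lipschitz_imp_abs_cont_fun_on)
    fix u v :: real
    assume uv: "0 \<le> u" "u \<le> v" "v \<le> 1"
    have "cmod (deriv_unit (s - 1) f v - deriv_unit (s - 1) f u) = cmod (C (s - 1)) * cmod (osc k v - osc k u)"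
      using eq[of u] eq[of v] uv by (simp add: norm_mult flip: right_diff_distrib)
    also have "\<dots> \<le> cmod (C (s - 1)) * (2 * pi * of_int \<bar>k\<bar> * (v - u))"
      using uv by (intro mult_left_mono osc_Lipschitz) auto
    finally show "cmod (deriv_unit (s - 1) f v - deriv_unit (s - 1) f u) \<le>
        cmod (C (s - 1)) * (2 * pi * of_int \<bar>k\<bar>) * (v - u)"
      by (simp only: mult.assoc)
  qed
  moreover have "deriv_unit s f \<in> L2_unit"
  proof -
    have "integrable unit_lebesgue (\<lambda>x. C s * osc k x)"
      by (intro continuous_imp_integrable_unit continuous_intros)
    then have "(\<lambda>x. C s * osc k x) \<in> borel_measurable unit_lebesgue"
      by (rule borel_measurable_integrable)
    then have "deriv_unit s f \<in> borel_measurable unit_lebesgue"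
      using eq by (subst measurable_cong[of _ _ "\<lambda>x. C s * osc k x"]) auto
    moreover have "integrable unit_lebesgue (\<lambda>x. (cmod (C s))\<^sup>2)"
      by (intro finite_measure.integrable_const finite_measure_unit_lebesgue)
    then have "integrable unit_lebesgue (\<lambda>x. (cmod (deriv_unit s f x))\<^sup>2)"
      using eq by (subst Bochner_Integration.integrable_cong[of _ _ _ "\<lambda>x. (cmod (C s))\<^sup>2"]) (auto simp: norm_mult)
    ultimately show ?thesis
      by (simp add: L2_unit_def)
  qed
  ultimately have "f \<in> periodic_sobolev s"
    using diff eq unfolding periodic_sobolev_def sobolev_def
    by (auto simp: differentiable_on_def intro!: AE_I2)
  then show ?thesis
    by (simp add: f_def)
qed

lemma fourier_int_osc: "fourier_int h (\<lambda>x. a * osc k x) = (if h = k then a else 0)"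
proof -
  have "fourier_int h (\<lambda>x. a * osc k x) = a * (LINT x|unit_lebesgue. osc (k - h) x)"
    using osc_mult[of k _ "- h"] by (simp add: fourier_int_eq_osc mult.assoc)
  then show ?thesis
    by (simp add: integral_osc)
qed

lemma sobolev_norm_osc:
  assumes "s \<ge> 1"
  shows "sobolev_norm s (\<lambda>x. a * osc k x) = cmod a * (if k = 0 then 1 else (2 * pi * of_int \<bar>k\<bar>) ^ s)"
proof -
  define C where "C l = a * (2 * pi * \<i> * of_int k) ^ l" for l
  have eq: "deriv_unit l (\<lambda>x. a * osc k x) x = C l * osc k x" if "x \<in> {0..1}" for l x
    using deriv_unit_osc[OF that] by (simp add: C_def)
  have "fourier_int 0 (deriv_unit l (\<lambda>x. a * osc k x)) = fourier_int 0 (\<lambda>x. C l * osc k x)" for l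
    unfolding fourier_int_eq_osc using eq by (intro Bochner_Integration.integral_cong) auto
  then have "fourier_int 0 (deriv_unit l (\<lambda>x. a * osc k x)) = (if k = 0 \<and> l = 0 then a else 0)" for l
    by (simp add: fourier_int_osc C_def)
  then have "(\<Sum>l<s. (cmod (fourier_int 0 (deriv_unit l (\<lambda>x. a * osc k x))))\<^sup>2) =
      (\<Sum>l<s. if l = 0 then (if k = 0 then (cmod a)\<^sup>2 else 0) else 0)"
    by (intro sum.cong) auto
  also have "\<dots> = (if k = 0 then (cmod a)\<^sup>2 else 0)"
    using assms by simp
  moreover have "(LINT x|unit_lebesgue. (cmod (deriv_unit s (\<lambda>x. a * osc k x) x))\<^sup>2) =
      (LINT x|unit_lebesgue. (cmod (C s))\<^sup>2)"
    using eq by (intro Bochner_Integration.integral_cong) (auto simp: norm_mult)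
  then have "(LINT x|unit_lebesgue. (cmod (deriv_unit s (\<lambda>x. a * osc k x) x))\<^sup>2) = (cmod (C s))\<^sup>2"
    by (simp add: measure_restrict_space)
  moreover have "cmod (C s) = cmod a * (2 * pi * of_int \<bar>k\<bar>) ^ s"
    by (simp add: C_def norm_mult norm_power)
  ultimately show ?thesis
    using assms by (simp add: sobolev_norm_def Re_sobolev_inner power_0_left)
qed

lemma periodic_wce_le:
  assumes "\<And>f. f \<in> periodic_sobolev s \<Longrightarrow> sobolev_norm s f \<le> 1 \<Longrightarrow> cmod (fourier_int k f - A f) \<le> b"
  shows "periodic_wce s k A \<le> ereal b"
  unfolding periodic_wce_def using assms by (intro SUP_least) auto

text \<open>
  For \<open>k = 0\<close> the top derivative says nothing about the coefficient; there the mean value of \<open>f\<close> in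
  the norm gives the bound. In both cases the oscillation of frequency \<open>k\<close>, scaled to norm \<open>1\<close>, is
  extremal.
\<close>

lemma periodic_wce_zero_algorithm:
  assumes "s \<ge> 1" and A: "\<And>f. A f = 0"
  shows "periodic_wce s k A = ereal (if k = 0 then 1 else 1 / (2 * pi * of_int \<bar>k\<bar>) ^ s)"
    (is "_ = ereal ?b")
proof (rule antisym)
  show "periodic_wce s k A \<le> ereal ?b"
    using assms sobolev_unit_ball(2) fourier_int_norm_le by (intro periodic_wce_le) auto
  define f where "f = (\<lambda>x. of_real ?b * osc k x)"
  have "f \<in> periodic_sobolev s"
    unfolding f_def by (rule osc_in_periodic_sobolev)
  moreover have "sobolev_norm s f \<le> 1"
    unfolding f_def sobolev_norm_osc[OF \<open>s \<ge> 1\<close>] by simp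
  moreover have "cmod (fourier_int k f - A f) = ?b"
    unfolding f_def A fourier_int_osc by simp
  ultimately show "ereal ?b \<le> periodic_wce s k A"
    unfolding periodic_wce_def by (intro SUP_upper2[of f]) auto
qed

theorem corollary7:
  fixes s n :: nat and k :: int
  assumes "s \<ge> 1"
  shows "(k = 0 \<and> n = 0 \<longrightarrow> periodic_wce s k (A_star k n) = 1) \<and>
    (k \<noteq> 0 \<and> int n < 2 * \<bar>k\<bar> \<longrightarrow>
       periodic_wce s k (A_star k n) = ereal (1 / (2 * pi * real_of_int \<bar>k\<bar>) ^ s)) \<and>
    (int n \<ge> max 1 (2 * \<bar>k\<bar>) \<longrightarrow>
       periodic_wce s k (A_star k n)
         \<le> ereal (2 / (2 * pi) ^ s * (1 / (real n - real_of_int \<bar>k\<bar>) ^ s))) \<and>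
    (n \<ge> 1 \<longrightarrow>
       periodic_wce s k (A_star k n)
         \<le> ereal ((3 / (2 * pi)) ^ s * (2 / (real n + real_of_int \<bar>k\<bar>) ^ s)))"
proof -
  have small: "periodic_wce s k (A_star k n) = ereal (if k = 0 then 1 else 1 / (2 * pi * of_int \<bar>k\<bar>) ^ s)"
    if "n = 0 \<or> int n < 2 * \<bar>k\<bar>"
    using that by (intro periodic_wce_zero_algorithm assms) (auto simp: A_star_def)
  have large: "periodic_wce s k (A_star k n) \<le> ereal (2 / (2 * pi * (real n - of_int \<bar>k\<bar>)) ^ s)"
    if "int n \<ge> max 1 (2 * \<bar>k\<bar>)"
    using that QMC_error[OF _ _ assms, of _ n k] by (intro periodic_wce_le) (auto simp: A_star_def)
  \<comment> \<open>Both error regimes are bounded by the same expression, with \<open>(n + \<bar>k\<bar>) / 3\<close> as the frequency.\<close>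
  have "(3 / (2 * pi)) ^ s * (2 / (real n + real_of_int \<bar>k\<bar>) ^ s) =
      2 / (2 * pi * ((real n + of_int \<bar>k\<bar>) / 3)) ^ s"
    by (simp add: power_mult_distrib power_divide)
  moreover have "periodic_wce s k (A_star k n) \<le> ereal (2 / (2 * pi * ((real n + of_int \<bar>k\<bar>) / 3)) ^ s)"
    if "n \<ge> 1"
  proof (cases "int n < 2 * \<bar>k\<bar>")
    case True
    have "k \<noteq> 0"
      using True by auto
    have "real n \<le> 2 * \<bar>real_of_int k\<bar>"
      using True by linarith
    then have "(real n + of_int \<bar>k\<bar>) / 3 \<le> of_int \<bar>k\<bar>"
      by simp
    then have "1 / (2 * pi * of_int \<bar>k\<bar>) ^ s \<le> 2 / (2 * pi * ((real n + of_int \<bar>k\<bar>) / 3)) ^ s"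
      using \<open>n \<ge> 1\<close> by (intro frac_le power_mono mult_left_mono zero_less_power mult_pos_pos) auto
    then show ?thesis
      using small True \<open>k \<noteq> 0\<close> by simp
  next
    case False
    then have "2 * \<bar>real_of_int k\<bar> \<le> real n"
      by linarith
    then have "(real n + of_int \<bar>k\<bar>) / 3 \<le> real n - of_int \<bar>k\<bar>"
      by simp
    then have "2 / (2 * pi * (real n - of_int \<bar>k\<bar>)) ^ s \<le> 2 / (2 * pi * ((real n + of_int \<bar>k\<bar>) / 3)) ^ s"
      using \<open>n \<ge> 1\<close> by (intro frac_le power_mono mult_left_mono zero_less_power mult_pos_pos) auto
    moreover have "int n \<ge> max 1 (2 * \<bar>k\<bar>)"
      using False \<open>n \<ge> 1\<close> by simp
    ultimately show ?thesis
      using large by (meson ereal_less_eq(3) order_trans)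
  qed
  ultimately have all: "periodic_wce s k (A_star k n) \<le>
      ereal ((3 / (2 * pi)) ^ s * (2 / (real n + of_int \<bar>k\<bar>) ^ s))" if "n \<ge> 1"
    using that by metis
  have "2 / (2 * pi * (real n - of_int \<bar>k\<bar>)) ^ s = 2 / (2 * pi) ^ s * (1 / (real n - of_int \<bar>k\<bar>) ^ s)"
    by (simp only: power_mult_distrib times_divide_times_eq mult_1_right)
  with large have large': "periodic_wce s k (A_star k n) \<le>
      ereal (2 / (2 * pi) ^ s * (1 / (real n - of_int \<bar>k\<bar>) ^ s))" if "int n \<ge> max 1 (2 * \<bar>k\<bar>)"
    using that by metis
  show ?thesis
  proof (intro conjI impI)
    assume "k = 0 \<and> n = 0"
    then show "periodic_wce s k (A_star k n) = 1"
      using small by (simp only: one_ereal_def simp_thms if_True)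
  next
    assume "k \<noteq> 0 \<and> int n < 2 * \<bar>k\<bar>"
    then show "periodic_wce s k (A_star k n) = ereal (1 / (2 * pi * real_of_int \<bar>k\<bar>) ^ s)"
      using small by (simp only: simp_thms if_False)
  qed (use large' all in blast)+
qed

end
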